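(* Let $n\ge1$, let $f\in\mathcal{R}_n^+$ with $\deg f=n$, and let $\sigma=(\lambda_1,\dots,\lambda_n)\in\mathbb{D}^n$ be such that $1/\overline{\lambda_1},\dots,1/\overline{\lambda_n}$ are the poles of $f$ counted with multiplicities (including poles at $\infty$, which correspond to $\lambda_k=0$). For any $\alpha>-1$ and $1<p<\infty$ with $p>1+\alpha$, we have $$\|f'\|_{A_p(\alpha)}\le K_{p,\alpha}\,\|f\|_{BMOA}\,\|B_\sigma'\|_{A_p(\alpha)},$$ where $$K_{p,\alpha}^p=\frac{2^{\frac1{\alpha+1}}}{2^{\frac1{\alpha+1}}-1}\left(\frac{p}{p-1-\alpha}\right)^p2^{p+1}.$$
   Context: $\mathbb{D}$ is the open unit disc, $\mathbb{T}$ the unit circle, and $A$ the normalized area measure on $\mathbb{D}$. $\mathcal{R}_n^+$ is the set of rational functions $P/Q$ with $P,Q$ complex polynomials of degree at most $n$ and $Q(\xi)\ne0$ for $|\xi|\le1$. The degree of a rational function in lowest terms $P/Q$ is $\max(\deg P,\deg Q)$, i.e. the number of its poles on the Riemann sphere counted with multiplicity. For $\sigma=(\lambda_1,\dots,\lambda_n)\in\mathbb{D}^n$, $B_\sigma=\prod_{k=1}^n b_{\lambda_k}$ with $b_\lambda(z)=\frac{\lambda-z}{1-\overline\lambda z}$. For holomorphic $h$ in $\mathbb{D}$, $\|h\|_{A_p(\alpha)}^p=\int_{\mathbb{D}}(1-|u|^2)^\alpha|h(u)|^p\,dA(u)$. For $f$ holomorphic in $\mathbb{D}$, $\|f\|_{BMOA}=\inf\|g\|_{L^\infty(\mathbb{T})}$,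 the infimum being over all $g\in L^\infty(\mathbb{T})$ such that $f(\xi)=\frac{1}{2\pi i}\int_{\mathbb{T}}\frac{g(u)}{u-\xi}\,du$ for $|\xi|<1$. *)

theory Defs
  imports
    "HOL-Complex_Analysis.Complex_Analysis"
    "HOL-Probability.Essential_Supremum"
begin

section \<open>Rational functions, their degree and their poles\<close>

definition ratfuns_plus :: "nat \<Rightarrow> (complex \<Rightarrow> complex) set" where
  "ratfuns_plus n = {f. \<exists>P Q :: complex poly.
     degree P \<le> n \<and> degree Q \<le> n \<and> (\<forall>\<xi>. norm \<xi> \<le> 1 \<longrightarrow> poly Q \<xi> \<noteq> 0) \<and>
     f = (\<lambda>z. poly P z / poly Q z)}"

text \<open>Two polynomial fractions define the same rational function iff their values (with
  \<open>x / 0 = 0\<close>) agree off a finite set, hence the finite exceptional set: it absorbs zeros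
  common to the numerator and the denominator. The fraction in lowest terms is unique up to a
  constant factor, so that the \<open>THE\<close> is well defined for every rational function.\<close>

definition rat_degree :: "(complex \<Rightarrow> complex) \<Rightarrow> nat" where
  "rat_degree f = (THE d. \<exists>P Q :: complex poly.
     Q \<noteq> 0 \<and> coprime P Q \<and> finite {z. f z \<noteq> poly P z / poly Q z} \<and>
     d = max (degree P) (degree Q))"

definition pole_mult :: "(complex \<Rightarrow> complex) \<Rightarrow> complex \<Rightarrow> nat" where
  "pole_mult f w = (if is_pole f w then nat (- zorder f w) else 0)"

definition pole_mult_infinity :: "(complex \<Rightarrow> complex) \<Rightarrow> nat" where
  "pole_mult_infinity f = pole_mult (\<lambda>z. f (1 / z)) 0"

text \<open>The points \<open>1 / cnj (l k)\<close>, with \<open>1 \<le> k \<le> n\<close>, are the poles of \<open>f\<close> on the Riemann sphere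
  counted with multiplicities. An index with \<open>l k = 0\<close> stands for a pole at infinity; it is
  excluded from the first clause because \<open>1 / 0 = 0\<close>.\<close>

definition reflected_poles :: "(complex \<Rightarrow> complex) \<Rightarrow> nat \<Rightarrow> (nat \<Rightarrow> complex) \<Rightarrow> bool" where
  "reflected_poles f n l \<longleftrightarrow>
     (\<forall>w. pole_mult f w = card {k \<in> {1..n}. l k \<noteq> 0 \<and> 1 / cnj (l k) = w}) \<and>
     pole_mult_infinity f = card {k \<in> {1..n}. l k = 0}"

section \<open>Blaschke products\<close>

definition blaschke_factor :: "complex \<Rightarrow> complex \<Rightarrow> complex" where
  "blaschke_factor a z = (a - z) / (1 - cnj a * z)"

definition blaschke_product :: "nat \<Rightarrow> (nat \<Rightarrow> complex) \<Rightarrow> complex \<Rightarrow> complex" where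
  "blaschke_product n l z = (\<Prod>k=1..n. blaschke_factor (l k) z)"

section \<open>Norms\<close>

text \<open>The norms take values in \<open>[0, \<infinity>]\<close>. The following power is only meant for exponents
  \<open>r > 0\<close>.\<close>

definition ennreal_powr :: "ennreal \<Rightarrow> real \<Rightarrow> ennreal" where
  "ennreal_powr x r = (if x = top then top else ennreal (enn2real x powr r))"

definition bergman_norm :: "real \<Rightarrow> real \<Rightarrow> (complex \<Rightarrow> complex) \<Rightarrow> ennreal" where
  "bergman_norm p \<alpha> h = ennreal_powr
     ((\<integral>\<^sup>+ u \<in> ball 0 1. ennreal ((1 - (norm u)\<^sup>2) powr \<alpha> * norm (h u) powr p) \<partial>lborel)
        / ennreal pi) (1 / p)"

text \<open>The unit circle carries normalized arc length, as the image of Lebesgue measure on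
  \<open>[0, 1]\<close> under \<open>circlepath 0 1\<close>, that is, \<open>t \<mapsto> exp (2 \<pi> \<i> t)\<close>.\<close>

definition circle_Linf_norm :: "(complex \<Rightarrow> complex) \<Rightarrow> ennreal" where
  "circle_Linf_norm g =
     esssup (lebesgue_on {0..1}) (\<lambda>t. ennreal (norm (g (circlepath 0 1 t))))"

definition circle_Linf :: "(complex \<Rightarrow> complex) set" where
  "circle_Linf = {g. (\<lambda>t. g (circlepath 0 1 t)) \<in> borel_measurable (lebesgue_on {0..1}) \<and>
     circle_Linf_norm g < top}"

definition bmoa_norm :: "(complex \<Rightarrow> complex) \<Rightarrow> ennreal" where
  "bmoa_norm f = Inf (circle_Linf_norm ` {g \<in> circle_Linf. \<forall>\<xi> \<in> ball 0 1.
     f \<xi> = 1 / (2 * of_real pi * \<i>) * contour_integral (circlepath 0 1) (\<lambda>u. g u / (u - \<xi>))})"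

section \<open>The constant\<close>

definition K_const :: "real \<Rightarrow> real \<Rightarrow> real" where
  "K_const p \<alpha> =
     (2 powr (1 / (\<alpha> + 1)) / (2 powr (1 / (\<alpha> + 1)) - 1)
       * (p / (p - 1 - \<alpha>)) powr p * 2 powr (p + 1)) powr (1 / p)"

end

theory Submission
  imports
    Defs
    "HOL-Computational_Algebra.Field_as_Ring"
    "HOL-Computational_Algebra.Fundamental_Theorem_Algebra"
    "HOL-Computational_Algebra.Polynomial_Factorial"
begin

text \<open>
  Write \<open>B\<close> for the Blaschke product and let \<open>f\<close> be the Cauchy integral of a bounded \<open>g\<close> on the
  circle. Since \<open>f\<close> belongs to the model space of \<open>z * B\<close>, the reproducing kernel of \<open>f' \<xi>\<close> may be
  multiplied by \<open>(1 - cnj (B \<xi>) * B)\<^sup>2\<close>. The modified kernel has \<open>L\<^sup>1\<close> norm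
  \<open>(1 - \<bar>B \<xi>\<bar>\<^sup>2) / (1 - \<bar>\<xi>\<bar>\<^sup>2)\<close>, so that \<open>\<bar>f' \<xi>\<bar>\<close> is at most this quotient times the sup norm of
  \<open>g\<close>, hence times the BMOA norm of \<open>f\<close>. As \<open>\<bar>B\<bar> = 1\<close> on the circle, \<open>1 - \<bar>B \<xi>\<bar>\<close> is bounded by the
  integral of \<open>\<bar>B'\<bar>\<close> along the radius from \<open>\<xi>\<close> to the circle, and a weighted Hardy inequality
  bounds the resulting area integral by that of \<open>B'\<close>.
\<close>

section \<open>Poles of rational functions\<close>

text \<open>The unmodified kernel only gives |f' \<xi>| \<le> M / (1 - |\<xi>|^2), with M the sup
  norm of g. This is too weak: the p-th power of the right-hand side is not integrable against (1 -
  |\<xi>|^2)^\<alpha>, because p > 1 + \<alpha>. The numerator 1 - |B \<xi>|^2 supplies the missing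
  decay at the circle. Two requirements fix the modified kernel. It is integrated against an
  arbitrary bounded g of which only the Cauchy integral is known, so it must be a function of cnj u
  that is holomorphic beyond the closed disc; this is why cnj B enters and not B. Its L^1 norm
  should be computed exactly, which is what the square is for: the kernel of the derivative has
  modulus 1 / |u - \<xi>|^2 on the circle, and |1 - b * cnj B|^2, with b = B \<xi>, is there the
  real part of a function holomorphic in u, so that the Poisson formula evaluates the norm.\<close>

lemma pole_mult_fraction:
  fixes P Q :: "complex poly"
  assumes PQ: "coprime P Q" "Q \<noteq> 0" and fin: "finite E"
    and f: "\<And>z. z \<notin> E \<Longrightarrow> f z = poly P z / poly Q z"
  shows "pole_mult f w = order w Q"
proof -
  have open_E: "open (- (E - {w}))"
    using fin by (intro open_Compl finite_imp_closed) simp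
  have ev: "\<forall>\<^sub>F z in at w. f z = poly P z / poly Q z"
    by (rule eventually_mono [OF eventually_at_in_open [OF open_E]]) (use f in auto)
  have pole_eq: "is_pole f w \<longleftrightarrow> is_pole (\<lambda>z. poly P z / poly Q z) w"
    by (rule is_pole_cong [OF ev refl])
  show ?thesis
  proof (cases "poly Q w = 0")
    case False
    have "(\<lambda>z. poly P z / poly Q z) holomorphic_on {z. poly Q z \<noteq> 0}"
      by (intro holomorphic_intros) auto
    moreover have "open {z. poly Q z \<noteq> 0}"
      by (intro open_Collect_neq continuous_intros)
    ultimately have "\<not> is_pole f w"
      unfolding pole_eq using False by (intro not_is_pole_holomorphic [of "{z. poly Q z \<noteq> 0}"]) auto
    then show ?thesis
      using False by (simp add: pole_mult_def order_0I)
  next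
    case True
    have Pw: "poly P w \<noteq> 0"
      using coprime_poly_0 [OF PQ(1), of w] True by simp
    obtain R where R: "Q = [:- w, 1:] ^ order w Q * R" "poly R w \<noteq> 0"
      using order_decomp [OF PQ(2), of w] by (auto simp: poly_eq_0_iff_dvd)
    have finQ: "finite {z. poly Q z = 0}"
      using poly_roots_finite [OF PQ(2)] .
    have open_Q: "open (- ({z. poly Q z = 0} - {w}))"
      using finQ by (intro open_Compl finite_imp_closed) simp
    have "filterlim (poly Q) (at 0) (at w)"
    proof (rule filterlim_atI)
      show "(poly Q \<longlongrightarrow> 0) (at w)"
        using poly_isCont [of w Q] True by (simp add: isCont_def)
      show "\<forall>\<^sub>F z in at w. poly Q z \<noteq> 0"
        by (rule eventually_mono [OF eventually_at_in_open [OF open_Q]]) auto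
    qed
    then have pole: "is_pole f w"
      unfolding pole_eq using Pw by (intro is_pole_divide) auto
    have "zorder f w = - int (order w Q)"
    proof (rule zorder_eqI)
      let ?S = "- (E - {w}) \<inter> - ({z. poly Q z = 0} - {w})"
      have Rz: "poly R z \<noteq> 0" if "z \<in> ?S" for z
      proof (cases "z = w")
        case False
        then have "poly Q z \<noteq> 0" using that by auto
        then show ?thesis by (subst (asm) R(1)) simp
      qed (use R(2) in simp)
      show "open ?S" using open_E open_Q by blast
      show "w \<in> ?S" by simp
      show "(\<lambda>z. poly P z / poly R z) holomorphic_on ?S"
        using Rz by (intro holomorphic_intros) auto
      show "poly P w / poly R w \<noteq> 0" using Pw R(2) by simp
      show "f z = poly P z / poly R z * (z - w) powi (- int (order w Q))" if "z \<in> ?S" "z \<noteq> w" for z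
      proof -
        have "f z = poly P z / poly Q z" using f that by auto
        also have "poly Q z = (z - w) ^ order w Q * poly R z"
          by (subst R(1)) (simp add: poly_power)
        finally show ?thesis
          by (simp add: power_int_minus field_simps)
      qed
    qed
    then show ?thesis using pole by (simp add: pole_mult_def)
  qed
qed

text \<open>In lowest terms the roots of the denominator are the points \<open>1 / cnj (l k)\<close>
  with \<open>l k \<noteq> 0\<close>. An index with \<open>l k = 0\<close> contributes the factor 1,
  so the product may run over all of \<open>{1..n}\<close>; a pole at infinity is hidden in the
  degree of \<open>P\<close>, which may exceed that of the denominator.\<close>

lemma ratfuns_plus_reflected_poles:
  assumes f: "f \<in> ratfuns_plus n" and poles: "reflected_poles f n l"
  obtains P where "degree P \<le> n"
    "\<And>z. norm z \<le> 1 \<Longrightarrow> f z = poly P z / (\<Prod>k=1..n. 1 - cnj (l k) * z)"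
proof -
  obtain P0 Q0 where PQ: "degree P0 \<le> n" "degree Q0 \<le> n"
    and nz: "\<And>\<xi>. norm \<xi> \<le> 1 \<Longrightarrow> poly Q0 \<xi> \<noteq> 0" and f_eq: "f = (\<lambda>z. poly P0 z / poly Q0 z)"
    using f by (auto simp: ratfuns_plus_def)
  have Q0: "Q0 \<noteq> 0" using nz [of 0] by auto
  define D where "D = gcd P0 Q0"
  have D: "D \<noteq> 0" using Q0 by (simp add: D_def)
  obtain P Q where P: "P0 = P * D" and Q: "Q0 = Q * D" and cop: "coprime P Q"
    using gcd_coprime_exists [of P0 Q0] D unfolding D_def by blast
  have Qnz: "Q \<noteq> 0" using Q Q0 by auto
  have degP: "degree P \<le> n"
    using PQ(1) D by (cases "P = 0") (auto simp: P degree_mult_eq)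
  define K where "K = {k \<in> {1..n}. l k \<noteq> 0}"
  define r where "r = (\<lambda>k. 1 / cnj (l k))"
  have K: "finite K" by (simp add: K_def)
  have "proots Q = image_mset r (mset_set K)"
  proof (rule multiset_eqI)
    fix w
    \<comment> \<open>The exceptional set consists of the zeros of \<open>D\<close>: there
      \<open>f\<close> is 0 by division by zero, while \<open>P / Q\<close> need not vanish.\<close>
    have "order w Q = pole_mult f w"
      by (rule pole_mult_fraction [symmetric, OF cop Qnz poly_roots_finite [OF D]])
         (simp add: f_eq P Q)
    also have "\<dots> = card {k \<in> K. r k = w}"
      using poles by (auto simp: reflected_poles_def K_def r_def intro!: arg_cong [where f = card])
    also have "\<dots> = count (image_mset r (mset_set K)) w"
      by (rule count_image_mset_eq_card_vimage [symmetric, OF K])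
    finally show "count (proots Q) w = count (image_mset r (mset_set K)) w"
      using Qnz by simp
  qed
  then have "Q = smult (lead_coeff Q) (\<Prod>k\<in>K. [:- r k, 1:])"
    using complex_poly_decompose_multiset [of Q]
    by (simp add: prod_unfold_prod_mset image_mset.compositionality comp_def)
  then have poly_Q: "poly Q z = lead_coeff Q * (\<Prod>k\<in>K. z - r k)" for z
    by (metis (no_types, lifting) poly_smult poly_prod prod.cong poly_pCons poly_0 add.commute
        diff_conv_add_uminus mult.right_neutral mult_zero_right add.right_neutral mult.commute)
  define c where "c = lead_coeff Q * (\<Prod>k\<in>K. - r k)"
  have c: "c \<noteq> 0" using Qnz K by (auto simp: c_def r_def K_def)
  have Q_eq: "poly Q z = c * (\<Prod>k=1..n. 1 - cnj (l k) * z)" for z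
  proof -
    have "(\<Prod>k\<in>K. z - r k) = (\<Prod>k\<in>K. - r k * (1 - cnj (l k) * z))"
      by (intro prod.cong) (auto simp: K_def r_def field_simps)
    also have "\<dots> = (\<Prod>k\<in>K. - r k) * (\<Prod>k\<in>K. 1 - cnj (l k) * z)"
      by (rule prod.distrib)
    also have "(\<Prod>k\<in>K. 1 - cnj (l k) * z) = (\<Prod>k=1..n. 1 - cnj (l k) * z)"
      by (intro prod.mono_neutral_left) (auto simp: K_def)
    finally show ?thesis
      by (simp add: poly_Q c_def)
  qed
  show thesis
  proof
    show "degree (smult (1 / c) P) \<le> n" using degP by (simp add: c)
    show "f z = poly (smult (1 / c) P) z / (\<Prod>k=1..n. 1 - cnj (l k) * z)" if "norm z \<le> 1" for z
    proof -
      have "poly D z \<noteq> 0" using nz [OF that] by (auto simp: Q)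
      then show ?thesis by (simp add: f_eq P Q Q_eq c)
    qed
  qed
qed

section \<open>Cauchy integrals of bounded functions on the circle\<close>

abbreviation unit_leb :: "real measure" where
  "unit_leb \<equiv> lebesgue_on {0..1}"

abbreviation ucirc :: "real \<Rightarrow> complex" where
  "ucirc \<equiv> circlepath 0 1"

lemma norm_ucirc [simp]: "norm (ucirc t) = 1"
  by (simp add: circlepath)

lemma ucirc_nonzero [simp]: "ucirc t \<noteq> 0"
  using norm_ucirc [of t] by (metis norm_zero zero_neq_one)

lemma ucirc_mult_cnj [simp]: "ucirc t * cnj (ucirc t) = 1" "cnj (ucirc t) * ucirc t = 1"
  using complex_norm_square [of "ucirc t"] by (simp_all add: mult.commute del: complex_cnj_mult)

lemma cnj_ucirc: "cnj (ucirc t) = inverse (ucirc t)"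
  by (metis inverse_unique ucirc_mult_cnj(1))

lemma continuous_on_ucirc [continuous_intros]: "continuous_on S ucirc"
  unfolding circlepath_def part_circlepath_def linepath_def by (intro continuous_intros)

lemma finite_measure_unit_leb: "finite_measure unit_leb"
  by (intro finite_measureI) (simp add: emeasure_restrict_space)

lemma continuous_measurable_unit_leb:
  fixes \<phi> :: "real \<Rightarrow> 'a::euclidean_space"
  assumes "continuous_on {0..1} \<phi>"
  shows "\<phi> \<in> borel_measurable unit_leb"
  by (rule continuous_imp_measurable_on_sets_lebesgue [OF assms]) auto

lemma integrable_bounded_mult_continuous:
  fixes G \<phi> :: "real \<Rightarrow> complex"
  assumes G: "G \<in> borel_measurable unit_leb" "AE t in unit_leb. norm (G t) \<le> M"
    and \<phi>: "continuous_on {0..1} \<phi>"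
  shows "integrable unit_leb (\<lambda>t. G t * \<phi> t)"
proof -
  interpret finite_measure unit_leb by (rule finite_measure_unit_leb)
  obtain C where C: "\<And>t. t \<in> {0..1} \<Longrightarrow> norm (\<phi> t) \<le> C"
    using compact_imp_bounded [OF compact_continuous_image [OF \<phi> compact_Icc]]
    unfolding bounded_iff by (metis imageI)
  have "AE t in unit_leb. norm (\<phi> t) \<le> C"
    using C by (intro AE_I2) (auto simp: space_restrict_space)
  with G(2) have "AE t in unit_leb. norm (G t * \<phi> t) \<le> M * C"
    by eventually_elim (simp add: norm_mult, meson dual_order.trans mult_mono norm_ge_zero)
  then show ?thesis
    using G(1) continuous_measurable_unit_leb [OF \<phi>]
    by (intro integrable_const_bound [where B = "M * C"]) auto
qed

lemma integrable_continuous_unit_leb: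
  fixes \<phi> :: "real \<Rightarrow> 'a::euclidean_space"
  assumes "continuous_on {0..1} \<phi>"
  shows "integrable unit_leb \<phi>"
proof -
  interpret finite_measure unit_leb by (rule finite_measure_unit_leb)
  obtain C where C: "\<And>t. t \<in> {0..1} \<Longrightarrow> norm (\<phi> t) \<le> C"
    using compact_imp_bounded [OF compact_continuous_image [OF assms compact_Icc]]
    unfolding bounded_iff by (metis imageI)
  then show ?thesis
    by (intro integrable_const_bound [where B = C] AE_I2 continuous_measurable_unit_leb assms)
       (auto simp: space_restrict_space)
qed

text \<open>For u = \<open>ucirc t\<close> one has du = 2 pi i u dt. Contour integrals thereby
  become Lebesgue integrals, in which the boundary function need only be measurable and bounded
  almost everywhere.\<close>

lemma contour_integral_ucirc:
  assumes "integrable unit_leb (\<lambda>t. h (ucirc t) * ucirc t)"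
  shows "1 / (2 * of_real pi * \<i>) * contour_integral ucirc h
           = (\<integral>t. h (ucirc t) * ucirc t \<partial>unit_leb)"
proof -
  have "contour_integral ucirc h = integral {0..1} (\<lambda>t. (2 * of_real pi * \<i>) * (h (ucirc t) * ucirc t))"
    unfolding contour_integral_integral vector_derivative_circlepath
    by (simp add: circlepath algebra_simps)
  also have "\<dots> = (2 * of_real pi * \<i>) * (\<integral>t. h (ucirc t) * ucirc t \<partial>unit_leb)"
    using lebesgue_integral_eq_integral [OF assms] by simp
  finally show ?thesis by simp
qed

lemma norm_lt_1_neq_ucirc:
  assumes "norm \<xi> < 1"
  shows "ucirc t \<noteq> \<xi>" "1 - cnj \<xi> * ucirc t \<noteq> 0" "1 - \<xi> * cnj (ucirc t) \<noteq> 0"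
proof -
  show "ucirc t \<noteq> \<xi>"
    using assms norm_ucirc [of t] by (metis less_irrefl)
  have "norm (cnj \<xi> * ucirc t) < 1" "norm (\<xi> * cnj (ucirc t)) < 1"
    using assms by (simp_all add: norm_mult del: circlepath)
  then show "1 - cnj \<xi> * ucirc t \<noteq> 0" "1 - \<xi> * cnj (ucirc t) \<noteq> 0"
    by (metis eq_iff_diff_eq_0 less_irrefl norm_one)+
qed

lemma Cauchy_unit_leb:
  assumes F: "continuous_on (cball 0 1) F" "F holomorphic_on ball 0 1" and \<xi>: "norm \<xi> < 1"
  shows "(\<integral>t. F (ucirc t) / (ucirc t - \<xi>) * ucirc t \<partial>unit_leb) = F \<xi>"
    and "(\<integral>t. F (ucirc t) / (ucirc t - \<xi>)\<^sup>2 * ucirc t \<partial>unit_leb) = deriv F \<xi>"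
proof -
  have cF: "continuous_on {0..1} (\<lambda>t. F (ucirc t))"
    by (rule continuous_on_compose2 [OF F(1) continuous_on_ucirc]) auto
  have nz: "ucirc t \<noteq> \<xi>" for t
    using norm_lt_1_neq_ucirc [OF \<xi>] by blast
  have "integrable unit_leb (\<lambda>t. F (ucirc t) / (ucirc t - \<xi>) * ucirc t)"
    by (intro integrable_continuous_unit_leb continuous_intros cF) (use nz in auto)
  from contour_integral_ucirc [of "\<lambda>u. F u / (u - \<xi>)", OF this]
  show "(\<integral>t. F (ucirc t) / (ucirc t - \<xi>) * ucirc t \<partial>unit_leb) = F \<xi>"
    using contour_integral_unique [OF Cauchy_integral_circlepath [of 0 1 F \<xi>]] F \<xi> by simp
  have "integrable unit_leb (\<lambda>t. F (ucirc t) / (ucirc t - \<xi>)\<^sup>2 * ucirc t)"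
    by (intro integrable_continuous_unit_leb continuous_intros cF) (use nz in auto)
  from contour_integral_ucirc [of "\<lambda>u. F u / (u - \<xi>)\<^sup>2", OF this]
  show "(\<integral>t. F (ucirc t) / (ucirc t - \<xi>)\<^sup>2 * ucirc t \<partial>unit_leb) = deriv F \<xi>"
    using DERIV_imp_deriv [OF Cauchy_derivative_integral_circlepath(2) [of 0 1 F \<xi>]] F \<xi> by simp
qed

text \<open>On the circle |u - \<xi>|^2 = (u - \<xi>) * (1 - cnj \<xi> * u) / u, so this is the
  Cauchy integral of \<open>F z / (1 - cnj \<xi> * z)\<close>, which is holomorphic in the disc and
  continuous up to the circle.\<close>

lemma Poisson_unit_leb:
  assumes F: "continuous_on (cball 0 1) F" "F holomorphic_on ball 0 1" and \<xi>: "norm \<xi> < 1"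
  shows "(\<integral>t. F (ucirc t) / of_real ((norm (ucirc t - \<xi>))\<^sup>2) \<partial>unit_leb)
           = F \<xi> / of_real (1 - (norm \<xi>)\<^sup>2)"
proof -
  define h where "h = (\<lambda>z. F z / (1 - cnj \<xi> * z))"
  have nz: "1 - cnj \<xi> * z \<noteq> 0" if "norm z \<le> 1" for z
  proof -
    have "norm (cnj \<xi> * z) < 1"
      using that \<xi> by (simp add: norm_mult) (meson le_less_trans mult_left_le norm_ge_zero)
    then show ?thesis by (metis eq_iff_diff_eq_0 less_irrefl norm_one)
  qed
  have "(\<integral>t. h (ucirc t) / (ucirc t - \<xi>) * ucirc t \<partial>unit_leb) = h \<xi>"
    unfolding h_def using nz
    by (intro Cauchy_unit_leb continuous_intros holomorphic_intros F \<xi>) auto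
  moreover have "h (ucirc t) / (ucirc t - \<xi>) * ucirc t
      = F (ucirc t) / of_real ((norm (ucirc t - \<xi>))\<^sup>2)" for t
  proof -
    have "of_real ((norm (ucirc t - \<xi>))\<^sup>2) = (ucirc t - \<xi>) * (cnj (ucirc t) - cnj \<xi>)"
      by (metis complex_cnj_diff complex_norm_square)
    also have "cnj (ucirc t) - cnj \<xi> = (1 - cnj \<xi> * ucirc t) / ucirc t"
      by (simp add: cnj_ucirc field_simps del: complex_cnj_inverse)
    finally show ?thesis
      by (simp add: h_def)
  qed
  moreover have "h \<xi> = F \<xi> / of_real (1 - (norm \<xi>)\<^sup>2)"
    by (simp only: h_def of_real_diff complex_norm_square) (simp add: mult.commute)
  ultimately show ?thesis by simp
qed

text \<open>Termwise integration: as \<open>cnj (ucirc t)\<close> has modulus 1, the series is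
  dominated by \<open>norm (G t)\<close> times the sum of the \<open>norm (a k)\<close>.\<close>

lemma sums_integral_unit_leb:
  fixes G :: "real \<Rightarrow> complex"
  assumes G: "G \<in> borel_measurable unit_leb" "AE t in unit_leb. norm (G t) \<le> M"
    and a: "summable (\<lambda>k. norm (a k))"
    and \<psi>: "\<And>x. norm x = 1 \<Longrightarrow> (\<lambda>k. a k * x ^ k) sums \<psi> x"
  shows "(\<lambda>k. a k * (\<integral>t. G t * cnj (ucirc t) ^ k \<partial>unit_leb))
           sums (\<integral>t. G t * \<psi> (cnj (ucirc t)) \<partial>unit_leb)"
proof -
  have int: "integrable unit_leb (\<lambda>t. G t * cnj (ucirc t) ^ k)" for k
    by (intro integrable_bounded_mult_continuous [OF G] continuous_intros)
  have intG: "integrable unit_leb G"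
    using integrable_bounded_mult_continuous [OF G, of "\<lambda>_. 1"] by simp
  define f where "f = (\<lambda>k t. a k * (G t * cnj (ucirc t) ^ k))"
  have "(\<lambda>k. integral\<^sup>L unit_leb (f k)) sums (\<integral>t. (\<Sum>k. f k t) \<partial>unit_leb)"
  proof (rule sums_integral)
    show "integrable unit_leb (f k)" for k
      unfolding f_def using int by auto
    have nf: "norm (f k t) = norm (a k) * norm (G t)" for k t
      by (simp add: f_def norm_mult norm_power)
    show "AE t in unit_leb. summable (\<lambda>k. norm (f k t))"
      unfolding nf using a by (intro AE_I2 summable_mult2)
    show "summable (\<lambda>k. \<integral>t. norm (f k t) \<partial>unit_leb)"
      unfolding nf using a by (simp add: summable_mult2)
  qed
  moreover have "(\<Sum>k. f k t) = G t * \<psi> (cnj (ucirc t))" for t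
  proof -
    have "(\<lambda>k. G t * (a k * cnj (ucirc t) ^ k)) sums (G t * \<psi> (cnj (ucirc t)))"
      by (intro sums_mult \<psi>) simp
    then show ?thesis
      by (simp add: f_def sums_iff mult.left_commute)
  qed
  moreover have "integral\<^sup>L unit_leb (f k) = a k * (\<integral>t. G t * cnj (ucirc t) ^ k \<partial>unit_leb)" for k
    by (simp add: f_def)
  ultimately show ?thesis by simp
qed

lemma holomorphic_abs_summable_power_series:
  assumes "\<psi> holomorphic_on ball 0 R" "R > 1"
  obtains a where "summable (\<lambda>k. norm (a k))" "\<And>x. norm x = 1 \<Longrightarrow> (\<lambda>k. a k * x ^ k) sums \<psi> x"
proof
  let ?a = "\<lambda>k. (deriv ^^ k) \<psi> 0 / fact k"
  have s: "(\<lambda>k. ?a k * x ^ k) sums \<psi> x" if "norm x < R" for x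
    using holomorphic_power_series [OF assms(1), of x] that by simp
  obtain r where r: "1 < r" "r < R"
    using assms(2) dense by blast
  have "summable (\<lambda>k. ?a k * of_real r ^ k)"
    using s [of "of_real r"] r by (auto simp: sums_iff)
  then show "summable (\<lambda>k. norm (?a k))"
    using powser_insidea [of ?a "of_real r" 1] r by simp
  show "(\<lambda>k. ?a k * x ^ k) sums \<psi> x" if "norm x = 1" for x
    using s that assms(2) by simp
qed

text \<open>Since u / (u - \<xi>) = 1 / (1 - \<xi> * cnj u), the geometric series shows that the
  moments are the Taylor coefficients at 0 of the Cauchy integral of \<open>d\<close>, which
  vanishes in the disc.\<close>

lemma vanishing_moments:
  fixes d :: "real \<Rightarrow> complex"
  assumes d: "d \<in> borel_measurable unit_leb" "AE t in unit_leb. norm (d t) \<le> M"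
    and z: "\<And>\<xi>. norm \<xi> < 1 \<Longrightarrow> (\<integral>t. d t / (ucirc t - \<xi>) * ucirc t \<partial>unit_leb) = 0"
  shows "(\<integral>t. d t * cnj (ucirc t) ^ k \<partial>unit_leb) = 0"
proof -
  define c where "c = (\<lambda>k. \<integral>t. d t * cnj (ucirc t) ^ k \<partial>unit_leb)"
  have s: "(\<lambda>k. c k * \<xi> ^ k) sums 0" if \<xi>: "norm \<xi> < 1" for \<xi>
  proof -
    have "(\<lambda>k. \<xi> ^ k * c k) sums (\<integral>t. d t * (1 / (1 - \<xi> * cnj (ucirc t))) \<partial>unit_leb)"
      unfolding c_def
    proof (rule sums_integral_unit_leb [OF d])
      show "summable (\<lambda>k. norm (\<xi> ^ k))"
        using \<xi> by (simp add: norm_power)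
      show "(\<lambda>k. \<xi> ^ k * x ^ k) sums (1 / (1 - \<xi> * x))" if "norm x = 1" for x
        using geometric_sums [of "\<xi> * x"] that \<xi> by (simp add: norm_mult power_mult_distrib)
    qed
    also have "(\<integral>t. d t * (1 / (1 - \<xi> * cnj (ucirc t))) \<partial>unit_leb)
        = (\<integral>t. d t / (ucirc t - \<xi>) * ucirc t \<partial>unit_leb)"
    proof (intro Bochner_Integration.integral_cong refl)
      fix t
      have "1 - \<xi> * cnj (ucirc t) = (ucirc t - \<xi>) / ucirc t"
        by (simp add: cnj_ucirc field_simps del: complex_cnj_inverse)
      then show "d t * (1 / (1 - \<xi> * cnj (ucirc t))) = d t / (ucirc t - \<xi>) * ucirc t"
        by simp
    qed
    finally show ?thesis
      using z [OF \<xi>] by (simp add: mult.commute)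
  qed
  have "c k = 0"
  proof (rule ccontr)
    assume k: "c k \<noteq> 0"
    have c0: "c 0 = 0"
      using s [of 0] powser_sums_zero_iff [of c 0] by simp
    \<comment> \<open>Uniqueness of coefficients in the form of \<open>powser_0_nonzero\<close>: a
      sum with \<open>c k \<noteq> 0\<close> that vanishes at 0 is nonzero at all other points near
      0, but here the sum is the zero function. Its requirement \<open>k > 0\<close> follows from
      \<open>c0\<close>.\<close>
    obtain r :: real where "r > 0" and r: "\<And>z::complex. z \<in> cball 0 r - {0} \<Longrightarrow> (0::complex) \<noteq> 0"
    proof (rule powser_0_nonzero [of 1 0 c "\<lambda>_. 0" k])
      show "(\<lambda>n. c n * (x - 0) ^ n) sums 0" if "norm (x - 0) < 1" for x
        using s that by simp
      show "k > 0" using k c0 by (cases k) auto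
    qed (use k in \<open>auto simp: cball_def\<close>)
    then show False
      using r [of "of_real r"] by simp
  qed
  then show ?thesis by (simp add: c_def)
qed

text \<open>To be applied to the difference of two boundary functions with the same Cauchy integral:
  a test function of this kind cannot tell them apart.\<close>

lemma Cauchy_orthogonal:
  fixes d :: "real \<Rightarrow> complex"
  assumes d: "d \<in> borel_measurable unit_leb" "AE t in unit_leb. norm (d t) \<le> M"
    and z: "\<And>\<xi>. norm \<xi> < 1 \<Longrightarrow> (\<integral>t. d t / (ucirc t - \<xi>) * ucirc t \<partial>unit_leb) = 0"
    and \<psi>: "\<psi> holomorphic_on ball 0 R" "R > 1"
  shows "(\<integral>t. d t * \<psi> (cnj (ucirc t)) \<partial>unit_leb) = 0"
proof -
  obtain a where a: "summable (\<lambda>k. norm (a k))" "\<And>x. norm x = 1 \<Longrightarrow> (\<lambda>k. a k * x ^ k) sums \<psi> x"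
    using holomorphic_abs_summable_power_series [OF \<psi>] by blast
  show ?thesis
    using sums_integral_unit_leb [OF d a] sums_unique2 [OF sums_zero]
    by (simp add: vanishing_moments [OF d z])
qed

text \<open>The extra factor \<open>cnj (ucirc t)\<close> leaves only the frequencies -1, -2, ...,
  all of mean zero; without it the constant term \<open>\<psi> 0\<close> would survive.\<close>

lemma integral_cnj_ucirc_mult_holomorphic:
  assumes \<psi>: "\<psi> holomorphic_on ball 0 R" "R > 1"
  shows "(\<integral>t. cnj (ucirc t) * \<psi> (cnj (ucirc t)) \<partial>unit_leb) = 0"
proof -
  obtain a where a: "summable (\<lambda>k. norm (a k))" "\<And>x. norm x = 1 \<Longrightarrow> (\<lambda>k. a k * x ^ k) sums \<psi> x"
    using holomorphic_abs_summable_power_series [OF \<psi>] by blast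
  have "(\<integral>t. cnj (ucirc t) * cnj (ucirc t) ^ k \<partial>unit_leb) = 0" for k
  proof -
    \<comment> \<open>The conjugate moment, read as Cauchy's formula at the origin for the power
      \<open>Suc k\<close>.\<close>
    have "(\<integral>t. (ucirc t) ^ Suc k / (ucirc t - 0) * ucirc t \<partial>unit_leb) = 0 ^ Suc k"
      by (intro Cauchy_unit_leb continuous_intros holomorphic_intros) auto
    then have "cnj (\<integral>t. ucirc t * (ucirc t) ^ k \<partial>unit_leb) = 0"
      by (simp add: mult.commute)
    moreover have "(\<integral>t. cnj (ucirc t * ucirc t ^ k) \<partial>unit_leb) = cnj (\<integral>t. ucirc t * (ucirc t) ^ k \<partial>unit_leb)"
      by (rule Bochner_Integration.integral_cnj)
    ultimately show ?thesis by simp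
  qed
  moreover have "(\<lambda>t. cnj (ucirc t)) \<in> borel_measurable unit_leb"
    by (intro continuous_measurable_unit_leb continuous_intros)
  ultimately show ?thesis
    using sums_integral_unit_leb [OF _ _ a, of "\<lambda>t. cnj (ucirc t)" 1] sums_unique2 [OF sums_zero]
    by simp
qed

section \<open>The pointwise estimate of the derivative\<close>

text \<open>Finitely many poles outside the closed disc stay outside a slightly larger one. The room
  between 1 and \<open>R\<close> is what makes the power series converge absolutely on the
  circle.\<close>

lemma norm_lt_1_imp_radius:
  fixes S :: "complex set"
  assumes "finite S" "\<And>a. a \<in> S \<Longrightarrow> norm a < 1"
  obtains R where "R > 1" "\<And>a z. a \<in> S \<Longrightarrow> z \<in> ball 0 R \<Longrightarrow> 1 - a * z \<noteq> 0"
proof -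
  obtain r where r: "0 < r" "r < 1" "\<And>a. a \<in> S \<Longrightarrow> norm a < r"
  proof -
    define m where "m = Max (insert 0 (norm ` S))"
    have m: "norm a \<le> m" if "a \<in> S" for a
      unfolding m_def using assms(1) that by (intro Max_ge) auto
    have "m < 1" "m \<ge> 0"
      unfolding m_def using assms by (auto simp: Max_ge_iff)
    moreover have "norm a < (m + 1) / 2" if "a \<in> S" for a
      using m [OF that] \<open>m < 1\<close> by simp
    ultimately show ?thesis
      by (intro that [of "(m + 1) / 2"]) simp_all
  qed
  show ?thesis
  proof
    show "1 / r > 1" using r by simp
    show "1 - a * z \<noteq> 0" if "a \<in> S" "z \<in> ball 0 (1 / r)" for a z
    proof -
      have "norm (a * z) \<le> r * norm z"
        using r(3) [OF that(1)] by (simp add: norm_mult mult_right_mono)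
      also have "\<dots> < 1" using that(2) r by (simp add: field_simps)
      finally show ?thesis by (metis eq_iff_diff_eq_0 less_irrefl norm_one)
    qed
  qed
qed

section \<open>Blaschke products and rational functions on the circle\<close>

lemma cnj_blaschke_product:
  "cnj (blaschke_product n l z) = blaschke_product n (\<lambda>k. cnj (l k)) (cnj z)"
  by (simp add: blaschke_product_def blaschke_factor_def)

lemma norm_blaschke_product_eq_1:
  assumes l: "\<And>k. k \<in> {1..n} \<Longrightarrow> norm (l k) < 1" and z: "norm z = 1"
  shows "norm (blaschke_product n l z) = 1"
proof -
  have "norm (blaschke_factor (l k) z) = 1" if "k \<in> {1..n}" for k
  proof -
    have zz: "z * cnj z = 1" using z by (simp add: complex_norm_square [symmetric])
    have "1 - cnj (l k) * z = z * cnj (z - l k)"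
      using zz by (simp add: algebra_simps)
    then have "norm (1 - cnj (l k) * z) = norm (l k - z)"
      by (simp only: norm_mult complex_mod_cnj z) (simp add: norm_minus_commute)
    moreover have "l k \<noteq> z" using l [OF that] z by auto
    ultimately show ?thesis by (simp add: blaschke_factor_def norm_divide)
  qed
  then show ?thesis
    unfolding blaschke_product_def by (simp add: prod_norm [symmetric])
qed

lemma holomorphic_on_blaschke_product [holomorphic_intros]:
  assumes "\<And>k z. k \<in> {1..n} \<Longrightarrow> z \<in> S \<Longrightarrow> 1 - cnj (l k) * z \<noteq> 0"
  shows "blaschke_product n l holomorphic_on S"
  unfolding blaschke_product_def [abs_def] blaschke_factor_def
  using assms by (intro holomorphic_intros) auto

lemma holomorphic_poly_over_prod:
  fixes a :: "nat \<Rightarrow> complex"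
  assumes "\<And>k z. k \<in> {1..n} \<Longrightarrow> z \<in> S \<Longrightarrow> 1 - a k * z \<noteq> 0"
  shows "(\<lambda>z. poly P z / (\<Prod>k=1..n. 1 - a k * z)) holomorphic_on S"
  using assms by (intro holomorphic_intros) auto

text \<open>On the circle \<open>cnj B\<close> is \<open>1 / B\<close>, which cancels the poles of \<open>F\<close> against zeros: this expresses
  that \<open>F\<close> lies in the model space of \<open>z * B\<close>.\<close>

lemma rational_times_cnj_blaschke:
  assumes P: "degree P \<le> n" and z: "norm z = 1"
    and l: "\<And>k. k \<in> {1..n} \<Longrightarrow> norm (l k) < 1"
  shows "poly P z / (\<Prod>k=1..n. 1 - cnj (l k) * z) * cnj (blaschke_product n l z)
    = (- 1) ^ n * (\<Sum>i\<le>n. coeff P i * cnj z ^ (n - i)) / (\<Prod>k=1..n. 1 - l k * cnj z)"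
proof -
  have zz: "z * cnj z = 1" using z by (simp add: complex_norm_square [symmetric])
  have nz: "l k \<noteq> z" if "k \<in> {1..n}" for k
    using l [OF that] z by auto
  have "(\<Prod>k=1..n. 1 - cnj (l k) * z) = (\<Prod>k=1..n. - z * (cnj (l k) - cnj z))"
    using zz by (intro prod.cong) (auto simp: algebra_simps)
  also have "\<dots> = (- z) ^ n * (\<Prod>k=1..n. cnj (l k) - cnj z)"
    by (subst prod.distrib) simp
  finally have T: "(\<Prod>k=1..n. 1 - cnj (l k) * z) = (- z) ^ n * (\<Prod>k=1..n. cnj (l k) - cnj z)" .
  have B: "cnj (blaschke_product n l z) = (\<Prod>k=1..n. cnj (l k) - cnj z) / (\<Prod>k=1..n. 1 - l k * cnj z)"
    by (simp add: blaschke_product_def blaschke_factor_def prod_dividef)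
  have nz': "(\<Prod>k=1..n. cnj (l k) - cnj z) \<noteq> 0"
    using nz by (auto simp flip: complex_cnj_diff)
  have "poly P z = (\<Sum>i\<le>n. coeff P i * z ^ i)"
    unfolding poly_altdef using P
    by (intro sum.mono_neutral_left) (auto simp: not_le coeff_eq_0)
  \<comment> \<open>The reversed polynomial: because \<open>degree P \<le> n\<close>, taking out
    \<open>z ^ n\<close>, the power that also comes out of the denominator, leaves only nonnegative
    powers of \<open>cnj z\<close>.\<close>
  also have "\<dots> = z ^ n * (\<Sum>i\<le>n. coeff P i * cnj z ^ (n - i))"
  proof -
    have "coeff P i * z ^ i = z ^ n * (coeff P i * cnj z ^ (n - i))" if "i \<le> n" for i
    proof -
      have "z ^ n = z ^ i * z ^ (n - i)" using that by (simp flip: power_add)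
      then have "z ^ n * cnj z ^ (n - i) = z ^ i * (z * cnj z) ^ (n - i)"
        by (simp only: power_mult_distrib mult.assoc)
      then show ?thesis by (simp only: zz power_one mult_1_right mult.left_commute)
    qed
    then show ?thesis unfolding sum_distrib_left by (intro sum.cong) auto
  qed
  finally have PZ: "poly P z = z ^ n * (\<Sum>i\<le>n. coeff P i * cnj z ^ (n - i))" .
  \<comment> \<open>Used with \<open>e = (- 1) ^ n\<close>, which is its own inverse.\<close>
  have cancel: "a * S / (e * a * C) * (C / D) = e * S / D"
    if "a \<noteq> 0" "C \<noteq> 0" "e * e = 1" for a S e C D :: complex
  proof -
    have "1 / e = e" using that(3) by (simp add: divide_eq_eq)
    have "a * S / (e * a * C) * (C / D) = (1 / e) * S / D" using that(1,2) by simp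
    then show ?thesis by (simp only: \<open>1 / e = e\<close>)
  qed
  have "(- 1 :: complex) ^ n * (- 1) ^ n = 1"
    by (simp flip: power_mult_distrib)
  moreover have "z ^ n \<noteq> 0" using z by auto
  ultimately show ?thesis
    unfolding T B PZ power_minus [of z] using nz' by (intro cancel)
qed

text \<open>The kernel \<open>x / (1 - \<xi> * x)\<^sup>2\<close>, with \<open>x = cnj \<zeta>\<close>, reproduces \<open>F' \<xi>\<close>. Multiplying it by
  \<open>(1 - b * cnj (B \<zeta>))\<^sup>2\<close>, where \<open>b = B \<xi>\<close>, does not affect the integral against \<open>F\<close>, and turns its
  \<open>L\<^sup>1\<close> norm into a reproducing kernel of the model space on the diagonal.\<close>

lemma deriv_rational_le:
  fixes P :: "complex poly" and n :: nat and l :: "nat \<Rightarrow> complex" and G :: "real \<Rightarrow> complex"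
  defines "F \<equiv> \<lambda>z. poly P z / (\<Prod>k=1..n. 1 - cnj (l k) * z)" and "B \<equiv> blaschke_product n l"
  assumes P: "degree P \<le> n" and l: "\<And>k. k \<in> {1..n} \<Longrightarrow> norm (l k) < 1"
    and G: "G \<in> borel_measurable unit_leb" "AE t in unit_leb. norm (G t) \<le> M"
    and GF: "\<And>\<xi>. norm \<xi> < 1 \<Longrightarrow> (\<integral>t. G t / (ucirc t - \<xi>) * ucirc t \<partial>unit_leb) = F \<xi>"
    and \<xi>: "norm \<xi> < 1"
  shows "norm (deriv F \<xi>) * (1 - (norm \<xi>)\<^sup>2) \<le> M * (1 - (norm (B \<xi>))\<^sup>2)"
proof -
  \<comment> \<open>The radius has to serve \<open>F\<close> and \<open>B\<close> (parameters
    \<open>cnj (l k)\<close>), their reflected counterparts \<open>H\<close> and \<open>Bt\<close>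
    (parameters \<open>l k\<close>), and the kernel (parameter \<open>\<xi>\<close>).\<close>
  obtain R where R: "R > 1" and
    nz: "\<And>a z. a \<in> insert \<xi> (l ` {1..n} \<union> (cnj \<circ> l) ` {1..n}) \<Longrightarrow> z \<in> ball 0 R \<Longrightarrow> 1 - a * z \<noteq> 0"
    by (rule norm_lt_1_imp_radius [of "insert \<xi> (l ` {1..n} \<union> (cnj \<circ> l) ` {1..n})"])
       (use \<xi> l in auto)
  have nz1: "1 - l k * z \<noteq> 0" "1 - cnj (l k) * z \<noteq> 0" if "k \<in> {1..n}" "z \<in> ball 0 R" for k z
    using nz [of "l k" z] nz [of "cnj (l k)" z] that by auto
  have nz2: "1 - \<xi> * z \<noteq> 0" if "z \<in> ball 0 R" for z
    using nz that by simp
  have sub: "cball 0 1 \<subseteq> ball (0::complex) R" "ball 0 1 \<subseteq> ball (0::complex) R" using R by auto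
  have holF: "F holomorphic_on ball 0 R"
    unfolding F_def using nz1 by (intro holomorphic_poly_over_prod) auto
  have holB: "B holomorphic_on ball 0 R"
    unfolding B_def using nz1 by (intro holomorphic_intros) auto
  define Bt where "Bt = blaschke_product n (\<lambda>k. cnj (l k))"
  have holBt: "Bt holomorphic_on ball 0 R"
    unfolding Bt_def using nz1 by (intro holomorphic_intros) auto
  have Bt: "Bt (cnj z) = cnj (B z)" for z
    by (simp add: Bt_def B_def cnj_blaschke_product)
  define H where "H = (\<lambda>x. (- 1) ^ n * (\<Sum>i\<le>n. coeff P i * x ^ (n - i)) / (\<Prod>k=1..n. 1 - l k * x))"
  have holH: "H holomorphic_on ball 0 R"
    unfolding H_def using nz1 by (intro holomorphic_intros) auto
  have H: "F (ucirc t) * Bt (cnj (ucirc t)) = H (cnj (ucirc t))" for t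
    unfolding F_def H_def Bt B_def using P l by (intro rational_times_cnj_blaschke) auto
  define b where "b = B \<xi>"
  define \<psi> where "\<psi> = (\<lambda>x. x * (1 - b * Bt x)\<^sup>2 / (1 - \<xi> * x)\<^sup>2)"
  have hol\<psi>: "\<psi> holomorphic_on ball 0 R"
    unfolding \<psi>_def using nz2 by (intro holomorphic_intros holBt) auto
  \<comment> \<open>From (1 - b * Bt)^2 = 1 + (b^2 * Bt - 2 * b) * Bt: the correction to the kernel
    contains a factor \<open>Bt\<close>, which turns \<open>F\<close> into \<open>H\<close>. The
    factor \<open>x\<close> of the kernel is kept aside, to make the integral of the correction
    vanish.\<close>
  define \<psi>2 where "\<psi>2 = (\<lambda>x. (b\<^sup>2 * Bt x - 2 * b) * H x / (1 - \<xi> * x)\<^sup>2)"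
  have hol\<psi>2: "\<psi>2 holomorphic_on ball 0 R"
    unfolding \<psi>2_def using nz2 by (intro holomorphic_intros holBt holH) auto
  have contF: "continuous_on (cball 0 1) F" and holF1: "F holomorphic_on ball 0 1"
    using holF sub by (auto intro: holomorphic_on_imp_continuous_on holomorphic_on_subset)
  have contB: "continuous_on (cball 0 1) B" and holB1: "B holomorphic_on ball 0 1"
    using holB sub by (auto intro: holomorphic_on_imp_continuous_on holomorphic_on_subset)
  have cont_cnj: "continuous_on {0..1} (\<lambda>t. h (cnj (ucirc t)))" if "h holomorphic_on ball 0 R" for h :: "complex \<Rightarrow> complex"
    using R by (intro continuous_on_compose2 [OF holomorphic_on_imp_continuous_on [OF that]] continuous_intros) auto
  have cFu: "continuous_on {0..1} (\<lambda>t. F (ucirc t))"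
    by (rule continuous_on_compose2 [OF contF continuous_on_ucirc]) auto
  have ker: "cnj (ucirc t) / (1 - \<xi> * cnj (ucirc t))\<^sup>2 = ucirc t / (ucirc t - \<xi>)\<^sup>2" for t
  proof -
    have "1 - \<xi> * cnj (ucirc t) = (ucirc t - \<xi>) * cnj (ucirc t)"
      by (simp add: algebra_simps)
    then show ?thesis
      using norm_lt_1_neq_ucirc(1) [OF \<xi>, of t]
      by (simp add: cnj_ucirc power2_eq_square field_simps del: complex_cnj_inverse)
  qed
  have FC: "(\<integral>t. F (ucirc t) * \<psi> (cnj (ucirc t)) \<partial>unit_leb) = deriv F \<xi>"
  proof -
    have split: "F (ucirc t) * \<psi> (cnj (ucirc t)) = F (ucirc t) / (ucirc t - \<xi>)\<^sup>2 * ucirc t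
        + cnj (ucirc t) * \<psi>2 (cnj (ucirc t))" for t
    proof -
      define x where "x = cnj (ucirc t)"
      have "F (ucirc t) * \<psi> x = F (ucirc t) * (x / (1 - \<xi> * x)\<^sup>2)
          + x * ((b\<^sup>2 * Bt x - 2 * b) * (F (ucirc t) * Bt x) / (1 - \<xi> * x)\<^sup>2)"
        by (simp add: \<psi>_def add_divide_distrib [symmetric]) (simp add: power2_eq_square algebra_simps)
      then show ?thesis
        using H [of t] ker [of t] by (simp add: x_def \<psi>2_def)
    qed
    have "(\<integral>t. F (ucirc t) / (ucirc t - \<xi>)\<^sup>2 * ucirc t + cnj (ucirc t) * \<psi>2 (cnj (ucirc t)) \<partial>unit_leb)
       = (\<integral>t. F (ucirc t) / (ucirc t - \<xi>)\<^sup>2 * ucirc t \<partial>unit_leb) + (\<integral>t. cnj (ucirc t) * \<psi>2 (cnj (ucirc t)) \<partial>unit_leb)"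
      using norm_lt_1_neq_ucirc(1) [OF \<xi>]
      by (intro Bochner_Integration.integral_add integrable_continuous_unit_leb continuous_intros cFu cont_cnj hol\<psi>2) auto
    then show ?thesis
      unfolding split Cauchy_unit_leb(2) [OF contF holF1 \<xi>]
        integral_cnj_ucirc_mult_holomorphic [OF hol\<psi>2 R] by simp
  qed
  \<comment> \<open>Here the arbitrary representative \<open>G\<close>, whose sup norm is to be
    used, takes the place of \<open>F\<close>: both have the same Cauchy integral, so
    \<open>\<psi>\<close> does not distinguish them.\<close>
  have "(\<integral>t. (G t - F (ucirc t)) * \<psi> (cnj (ucirc t)) \<partial>unit_leb) = 0"
  proof -
    obtain C where C: "\<And>t. t \<in> {0..1} \<Longrightarrow> norm (F (ucirc t)) \<le> C"
      using compact_imp_bounded [OF compact_continuous_image [OF cFu compact_Icc]]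
      unfolding bounded_iff by (metis imageI)
    show ?thesis
    proof (rule Cauchy_orthogonal [OF _ _ _ hol\<psi> R])
      show "(\<lambda>t. G t - F (ucirc t)) \<in> borel_measurable unit_leb"
        by (intro borel_measurable_diff G continuous_measurable_unit_leb cFu)
      have "AE t in unit_leb. norm (F (ucirc t)) \<le> C"
        using C by (intro AE_I2) (auto simp: space_restrict_space)
      with G(2) show "AE t in unit_leb. norm (G t - F (ucirc t)) \<le> M + C"
        by eventually_elim (meson add_mono norm_triangle_ineq4 order_trans)
      fix w :: complex assume w: "norm w < 1"
      have c: "continuous_on {0..1} (\<lambda>t. ucirc t / (ucirc t - w))"
        using norm_lt_1_neq_ucirc(1) [OF w] by (intro continuous_intros) auto
      have "(\<integral>t. (G t - F (ucirc t)) / (ucirc t - w) * ucirc t \<partial>unit_leb)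
          = (\<integral>t. G t / (ucirc t - w) * ucirc t - F (ucirc t) / (ucirc t - w) * ucirc t \<partial>unit_leb)"
        by (simp add: diff_divide_distrib left_diff_distrib)
      also have "\<dots> = (\<integral>t. G t / (ucirc t - w) * ucirc t \<partial>unit_leb) - (\<integral>t. F (ucirc t) / (ucirc t - w) * ucirc t \<partial>unit_leb)"
      proof (rule Bochner_Integration.integral_diff)
        show "integrable unit_leb (\<lambda>t. G t / (ucirc t - w) * ucirc t)"
          using integrable_bounded_mult_continuous [OF G c] by simp
        show "integrable unit_leb (\<lambda>t. F (ucirc t) / (ucirc t - w) * ucirc t)"
          using norm_lt_1_neq_ucirc(1) [OF w]
          by (intro integrable_continuous_unit_leb continuous_intros cFu) auto
      qed
      finally show "(\<integral>t. (G t - F (ucirc t)) / (ucirc t - w) * ucirc t \<partial>unit_leb) = 0"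
        using GF [OF w] Cauchy_unit_leb(1) [OF contF holF1 w] by simp
    qed
  qed
  moreover have intG: "integrable unit_leb (\<lambda>t. G t * \<psi> (cnj (ucirc t)))"
    by (intro integrable_bounded_mult_continuous [OF G] cont_cnj hol\<psi>)
  moreover have "integrable unit_leb (\<lambda>t. F (ucirc t) * \<psi> (cnj (ucirc t)))"
    by (intro integrable_continuous_unit_leb continuous_intros cFu cont_cnj hol\<psi>)
  ultimately have GC: "(\<integral>t. G t * \<psi> (cnj (ucirc t)) \<partial>unit_leb) = deriv F \<xi>"
    using FC by (simp add: left_diff_distrib)
  \<comment> \<open>The numerator is holomorphic in u, and the Poisson formula will evaluate it at
    \<xi>, where cnj b * B becomes |b|^2 and 1 + |b|^2 - 2 * |b|^2 is left.\<close>
  have n\<psi>: "norm (\<psi> (cnj (ucirc t)))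
      = Re ((of_real (1 + (norm b)\<^sup>2) - 2 * cnj b * B (ucirc t)) / of_real ((norm (ucirc t - \<xi>))\<^sup>2))" for t
  proof -
    have "norm (B (ucirc t)) = 1"
      unfolding B_def using l by (intro norm_blaschke_product_eq_1) auto
    then have BB: "B (ucirc t) * cnj (B (ucirc t)) = 1"
      by (simp add: complex_norm_square [symmetric])
    have "norm (1 - \<xi> * cnj (ucirc t)) = norm ((ucirc t - \<xi>) * cnj (ucirc t))"
      by (simp add: algebra_simps)
    then have d: "norm (1 - \<xi> * cnj (ucirc t)) = norm (ucirc t - \<xi>)"
      by (simp add: norm_mult)
    have "of_real ((norm (1 - b * cnj (B (ucirc t))))\<^sup>2)
        = (1 - b * cnj (B (ucirc t))) * (1 - cnj b * B (ucirc t))"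
      by (subst complex_norm_square) simp
    also have "\<dots> = 1 + b * cnj b * (B (ucirc t) * cnj (B (ucirc t)))
        - (cnj b * B (ucirc t) + cnj (cnj b * B (ucirc t)))"
      by (simp add: algebra_simps)
    also have "\<dots> = of_real (1 + (norm b)\<^sup>2 - 2 * Re (cnj b * B (ucirc t)))"
      by (simp only: BB complex_add_cnj mult_1_right) (simp only: complex_norm_square [symmetric], simp)
    finally have "(norm (1 - b * cnj (B (ucirc t))))\<^sup>2 = 1 + (norm b)\<^sup>2 - 2 * Re (cnj b * B (ucirc t))"
      unfolding of_real_eq_iff .
    then show ?thesis
      unfolding \<psi>_def by (simp add: norm_mult norm_divide norm_power d Bt Re_divide_of_real del: Re_divide)
  qed
  have int\<psi>: "(\<integral>t. norm (\<psi> (cnj (ucirc t))) \<partial>unit_leb) = (1 - (norm b)\<^sup>2) / (1 - (norm \<xi>)\<^sup>2)"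
  proof -
    define E where "E = (\<lambda>z. of_real (1 + (norm b)\<^sup>2) - 2 * cnj b * B z)"
    have contE: "continuous_on (cball 0 1) E" and holE: "E holomorphic_on ball 0 1"
      unfolding E_def by (intro continuous_intros holomorphic_intros contB holB1)+
    have cEu: "continuous_on {0..1} (\<lambda>t. E (ucirc t))"
      by (rule continuous_on_compose2 [OF contE continuous_on_ucirc]) auto
    have "integrable unit_leb (\<lambda>t. E (ucirc t) / of_real ((norm (ucirc t - \<xi>))\<^sup>2))"
      using norm_lt_1_neq_ucirc(1) [OF \<xi>]
      by (intro integrable_continuous_unit_leb continuous_intros cEu) auto
    moreover have "norm (\<psi> (cnj (ucirc t))) = Re (E (ucirc t) / of_real ((norm (ucirc t - \<xi>))\<^sup>2))" for t
      unfolding n\<psi> E_def ..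
    ultimately have "(\<integral>t. norm (\<psi> (cnj (ucirc t))) \<partial>unit_leb)
        = Re (\<integral>t. E (ucirc t) / of_real ((norm (ucirc t - \<xi>))\<^sup>2) \<partial>unit_leb)"
      by (simp only: Bochner_Integration.integral_Re)
    also have "\<dots> = Re (E \<xi> / of_real (1 - (norm \<xi>)\<^sup>2))"
      by (simp only: Poisson_unit_leb [OF contE holE \<xi>])
    also have "E \<xi> = of_real (1 + (norm b)\<^sup>2) - 2 * (b * cnj b)"
      by (simp add: E_def b_def)
    also have "\<dots> = of_real (1 - (norm b)\<^sup>2)"
      unfolding complex_norm_square [symmetric] by simp
    finally show ?thesis
      by (simp only: of_real_divide [symmetric] Re_complex_of_real)
  qed
  have "norm (deriv F \<xi>) \<le> (\<integral>t. norm (G t * \<psi> (cnj (ucirc t))) \<partial>unit_leb)"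
    unfolding GC [symmetric] by (rule integral_norm_bound)
  also have "\<dots> \<le> (\<integral>t. M * norm (\<psi> (cnj (ucirc t))) \<partial>unit_leb)"
  proof (rule integral_mono_AE)
    show "integrable unit_leb (\<lambda>t. norm (G t * \<psi> (cnj (ucirc t))))"
      using intG by (rule integrable_norm)
    show "integrable unit_leb (\<lambda>t. M * norm (\<psi> (cnj (ucirc t))))"
      by (intro integrable_continuous_unit_leb continuous_intros cont_cnj hol\<psi>)
    show "AE t in unit_leb. norm (G t * \<psi> (cnj (ucirc t))) \<le> M * norm (\<psi> (cnj (ucirc t)))"
      using G(2) by eventually_elim (simp add: norm_mult mult_right_mono)
  qed
  also have "\<dots> = M * ((1 - (norm b)\<^sup>2) / (1 - (norm \<xi>)\<^sup>2))"
    by (simp add: int\<psi>)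
  finally have "norm (deriv F \<xi>) \<le> M * ((1 - (norm b)\<^sup>2) / (1 - (norm \<xi>)\<^sup>2))" .
  moreover have "1 - (norm \<xi>)\<^sup>2 > 0"
    using \<xi> by (simp add: power_less_one_iff)
  ultimately show ?thesis
    by (simp add: b_def field_simps)
qed

section \<open>Hardy's inequality along radii\<close>

lemma nn_integral_scaleR:
  fixes f :: "'a::euclidean_space \<Rightarrow> ennreal"
  assumes [measurable]: "f \<in> borel_measurable borel" and c: "c > 0"
  shows "(\<integral>\<^sup>+x. f (c *\<^sub>R x) \<partial>lborel) = ennreal (1 / c ^ DIM('a)) * (\<integral>\<^sup>+x. f x \<partial>lborel)"
proof -
  have "(\<integral>\<^sup>+x. f x \<partial>lborel)
      = (\<integral>\<^sup>+x. f x \<partial>density (distr lborel borel (\<lambda>x. 0 + c *\<^sub>R x)) (\<lambda>_. \<bar>c\<bar> ^ DIM('a)))"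
    using lborel_affine [of c "0::'a"] c by simp
  also have "\<dots> = ennreal (c ^ DIM('a)) * (\<integral>\<^sup>+x. f (c *\<^sub>R x) \<partial>lborel)"
    using c by (simp add: nn_integral_density nn_integral_distr nn_integral_cmult)
  finally have "ennreal (1 / c ^ DIM('a)) * (\<integral>\<^sup>+x. f x \<partial>lborel)
      = ennreal (1 / c ^ DIM('a)) * ennreal (c ^ DIM('a)) * (\<integral>\<^sup>+x. f (c *\<^sub>R x) \<partial>lborel)"
    by (simp add: mult.assoc)
  also have "ennreal (1 / c ^ DIM('a)) * ennreal (c ^ DIM('a)) = 1"
    using c by (subst ennreal_mult [symmetric]) auto
  finally show ?thesis by simp
qed

text \<open>Jensen's inequality for the weight \<open>w\<close>, obtained by integrating a tangent
  line instead of normalizing: the mass of \<open>w\<close> is only bounded by \<open>W\<close>, and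
  the right-hand side may be infinite.\<close>

lemma jensen_powr_bound:
  fixes X w :: "'a \<Rightarrow> real"
  assumes p: "p > 1" and W: "W > 0" and A: "A \<ge> 0"
    and [measurable]: "X \<in> borel_measurable M" "w \<in> borel_measurable M"
    and nonneg: "\<And>t. X t \<ge> 0" "\<And>t. w t \<ge> 0"
    and w: "(\<integral>\<^sup>+t. ennreal (w t) \<partial>M) \<le> ennreal W"
    and A_le: "ennreal A \<le> (\<integral>\<^sup>+t. ennreal (X t * w t) \<partial>M)"
  shows "ennreal (A powr p) \<le> ennreal (W powr (p - 1)) * (\<integral>\<^sup>+t. ennreal (X t powr p * w t) \<partial>M)"
proof -
  \<comment> \<open>\<open>m\<close> is the value a constant \<open>X\<close> would take, and
    \<open>c\<close> is the slope of x^p / p at \<open>m\<close>; Young's inequality below is the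
    tangent line at that point.\<close>
  define m where "m = A / W"
  define c where "c = m powr (p - 1)"
  define J where "J = (\<integral>\<^sup>+t. ennreal (X t powr p * w t) \<partial>M)"
  have m: "m \<ge> 0" and c: "c \<ge> 0" using A W by (auto simp: m_def c_def)
  have cm: "c * m = m powr p"
    using m p by (cases "m = 0") (auto simp: c_def powr_diff)
  have young: "c * X t \<le> X t powr p / p + (1 - 1 / p) * m powr p" for t
  proof -
    define q where "q = p / (p - 1)"
    have q: "q > 1" "1 / p + 1 / q = 1" "1 / q = 1 - 1 / p"
      using p by (auto simp: q_def field_simps)
    have "X t * c \<le> X t powr p / p + c powr q / q"
      by (rule Youngs_inequality) (use p q nonneg c in auto)
    also have "c powr q = m powr p"
      using p by (simp add: c_def powr_powr q_def)
    finally show ?thesis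
      using q(3) by (simp add: mult.commute divide_inverse)
  qed
  have "ennreal (c * A) = ennreal c * ennreal A"
    using c A by (simp add: ennreal_mult)
  also have "\<dots> \<le> ennreal c * (\<integral>\<^sup>+t. ennreal (X t * w t) \<partial>M)"
    by (intro mult_left_mono A_le) auto
  also have "\<dots> = (\<integral>\<^sup>+t. ennreal (c * X t * w t) \<partial>M)"
    using c nonneg by (subst nn_integral_cmult [symmetric]) (auto simp: ennreal_mult' mult.assoc)
  also have "\<dots> \<le> (\<integral>\<^sup>+t. ennreal (1 / p) * ennreal (X t powr p * w t)
      + ennreal ((1 - 1 / p) * m powr p) * ennreal (w t) \<partial>M)"
  proof (intro nn_integral_mono)
    fix t
    have "c * X t * w t \<le> (X t powr p / p + (1 - 1 / p) * m powr p) * w t"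
      by (intro mult_right_mono young nonneg)
    also have "\<dots> = 1 / p * (X t powr p * w t) + (1 - 1 / p) * m powr p * w t"
      by (simp add: algebra_simps)
    finally show "ennreal (c * X t * w t) \<le> ennreal (1 / p) * ennreal (X t powr p * w t)
      + ennreal ((1 - 1 / p) * m powr p) * ennreal (w t)"
      using p nonneg by (simp add: ennreal_leI flip: ennreal_mult ennreal_plus)
  qed
  also have "\<dots> = ennreal (1 / p) * J + ennreal ((1 - 1 / p) * m powr p) * (\<integral>\<^sup>+t. ennreal (w t) \<partial>M)"
    unfolding J_def by (simp add: nn_integral_add nn_integral_cmult)
  also have "\<dots> \<le> ennreal (1 / p) * J + ennreal ((1 - 1 / p) * m powr p) * ennreal W"
    by (intro add_left_mono mult_left_mono w) auto
  finally have le: "ennreal (c * A) \<le> ennreal (1 / p) * J + ennreal ((1 - 1 / p) * m powr p * W)"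
    using p W by (simp add: ennreal_mult'')
  \<comment> \<open>As \<open>c * A = m powr p * W\<close>, the last term of \<open>le\<close> can
    be moved to the left, leaving the fraction 1 / p on both sides. The subtraction takes place in
    the reals, hence the case distinction on \<open>J\<close>.\<close>
  have "ennreal (m powr p * W) \<le> J"
  proof (cases J)
    case (real r)
    have cA: "c * A = m powr p * W"
      unfolding cm [symmetric] using W by (simp add: m_def)
    have "m powr p * W \<le> 1 / p * r + (1 - 1 / p) * m powr p * W"
    proof -
      have "ennreal (m powr p * W) \<le> ennreal (1 / p * r + (1 - 1 / p) * m powr p * W)"
        using le real p W unfolding cA by (simp flip: ennreal_mult ennreal_plus)
      then show ?thesis
        using real p W by (subst (asm) ennreal_le_iff) auto
    qed
    then have "m powr p * W \<le> r"
      using p by (simp add: field_simps)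
    then show ?thesis using real by (auto intro: ennreal_leI)
  qed auto
  then have "ennreal (W powr (p - 1)) * ennreal (m powr p * W) \<le> ennreal (W powr (p - 1)) * J"
    by (intro mult_left_mono) auto
  moreover have "W powr (p - 1) * (m powr p * W) = A powr p"
    using W A by (simp add: m_def powr_divide powr_diff)
  moreover have "ennreal (W powr (p - 1) * (m powr p * W)) = ennreal (W powr (p - 1)) * ennreal (m powr p * W)"
    by (intro ennreal_mult') simp
  ultimately show ?thesis
    unfolding J_def by simp
qed

text \<open>The total mass of the weight in the Hardy inequality. For \<open>\<delta> < 1\<close>
  the integrand is singular at \<open>1 / a\<close>; the antiderivative is still continuous there,
  so it suffices to differentiate it in the interior.\<close>

lemma nn_integral_powr_one_minus:
  fixes a \<delta> :: real
  assumes a: "0 < a" "a < 1" and \<delta>: "0 < \<delta>"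
  shows "(\<integral>\<^sup>+t. ennreal (indicator {1..<1 / a} t * (a * (1 - t * a) powr (\<delta> - 1))) \<partial>lborel)
           \<le> ennreal ((1 - a) powr \<delta> / \<delta>)"
proof -
  define F where "F = (\<lambda>t. - ((1 - t * a) powr \<delta>) / \<delta>)"
  have "((\<lambda>t. a * (1 - t * a) powr (\<delta> - 1)) has_integral F (1 / a) - F 1) {1..1 / a}"
  proof (rule fundamental_theorem_of_calculus_interior)
    show "1 \<le> 1 / a" using a by simp
    show "continuous_on {1..1 / a} F"
      unfolding F_def using a \<delta>
      by (intro continuous_intros continuous_on_powr') (auto simp: field_simps)
    show "(F has_vector_derivative a * (1 - t * a) powr (\<delta> - 1)) (at t)" if "t \<in> {1<..<1 / a}" for t
    proof -
      have "1 - t * a > 0" using that a by (simp add: field_simps)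
      then show ?thesis
        unfolding F_def has_real_derivative_iff_has_vector_derivative [symmetric] using \<delta>
        by (auto intro!: derivative_eq_intros simp: field_simps)
    qed
  qed
  then have "(\<integral>\<^sup>+t. ennreal (a * (1 - t * a) powr (\<delta> - 1)) * indicator {1..1 / a} t \<partial>lborel)
      = ennreal (F (1 / a) - F 1)"
    using a by (intro nn_integral_has_integral_lebesgue') auto
  also have "F (1 / a) - F 1 = (1 - a) powr \<delta> / \<delta>"
    using a by (simp add: F_def)
  finally show ?thesis
    by (rule order_eq_refl [THEN order_trans [rotated]], intro nn_integral_mono)
       (auto simp: indicator_def)
qed

text \<open>\<open>a / t\<^sup>2\<close> is the derivative of \<open>1 - a / t\<close>, so the
  antiderivative is explicit. The bound discards its limit \<open>- 1 / \<delta>\<close> at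
  infinity.\<close>

lemma nn_integral_inverse_square:
  fixes a \<delta> :: real
  assumes a: "0 \<le> a" "a < 1" and \<delta>: "0 < \<delta>"
  shows "(\<integral>\<^sup>+t. ennreal (indicator {1..} t * (a / t\<^sup>2 * (1 - a / t) powr (- \<delta> - 1))) \<partial>lborel)
           \<le> ennreal ((1 - a) powr (- \<delta>) / \<delta>)"
proof -
  define F where "F = (\<lambda>t::real. - ((1 - a / t) powr (- \<delta>)) / \<delta>)"
  define f where "f = (\<lambda>t::real. a / t\<^sup>2 * (1 - a / t) powr (- \<delta> - 1))"
  have pos: "0 < 1 - a / t" if "t \<ge> 1" for t
    using a that by (simp add: field_simps)
  have "(\<integral>\<^sup>+t. ennreal (f t) * indicator {1..} t \<partial>lborel) = ennreal (- 1 / \<delta> - F 1)"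
  proof (rule nn_integral_FTC_atLeast)
    show "f \<in> borel_measurable borel"
      unfolding f_def by measurable
    show "DERIV F t :> f t" if "1 \<le> t" for t
      unfolding F_def f_def using pos [OF that] that \<delta>
      by (auto intro!: derivative_eq_intros simp: power2_eq_square field_simps)
    show "0 \<le> f t" if "1 \<le> t" for t
      using a by (simp add: f_def)
    show "(F \<longlongrightarrow> - 1 / \<delta>) at_top"
    proof -
      have "((\<lambda>t. a / t) \<longlongrightarrow> 0) at_top"
        by (intro tendsto_divide_0 [OF tendsto_const] filterlim_at_top_imp_at_infinity filterlim_ident)
      then have "((\<lambda>t. - ((1 - a / t) powr (- \<delta>)) / \<delta>) \<longlongrightarrow> - ((1 - 0) powr (- \<delta>)) / \<delta>) at_top"
        using \<delta> by (intro tendsto_intros) auto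
      then show ?thesis by (simp add: F_def)
    qed
  qed
  also have "(\<integral>\<^sup>+t. ennreal (f t) * indicator {1..} t \<partial>lborel)
      = (\<integral>\<^sup>+t. ennreal (indicator {1..} t * (a / t\<^sup>2 * (1 - a / t) powr (- \<delta> - 1))) \<partial>lborel)"
    by (intro nn_integral_cong) (auto simp: f_def indicator_def)
  also have "ennreal (- 1 / \<delta> - F 1) \<le> ennreal ((1 - a) powr (- \<delta>) / \<delta>)"
    using \<delta> by (intro ennreal_leI) (simp add: F_def field_simps)
  finally show ?thesis .
qed

text \<open>The inner integral runs along the ray through \<open>u\<close>, which is parametrized by dilations
  so that the substitution \<open>v = t *\<^sub>R u\<close> replaces polar coordinates.\<close>

lemma radial_Hardy_inequality:
  fixes A G :: "'a::euclidean_space \<Rightarrow> real" and p \<alpha> :: real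
  defines "\<delta> \<equiv> (p - 1 - \<alpha>) / p"
  assumes p: "p > 1" "p > 1 + \<alpha>"
    and G [measurable]: "G \<in> borel_measurable borel" and G_nonneg: "\<And>v. G v \<ge> 0"
    and A: "\<And>u. 0 < norm u \<Longrightarrow> norm u < 1 \<Longrightarrow> A u \<ge> 0"
    and A_le: "\<And>u. 0 < norm u \<Longrightarrow> norm u < 1 \<Longrightarrow>
      ennreal (A u) \<le> (\<integral>\<^sup>+t. ennreal (indicator {1..<1 / norm u} t * (norm u * G (t *\<^sub>R u))) \<partial>lborel)"
  shows "(\<integral>\<^sup>+u. ennreal (indicator (ball 0 1) u * ((1 - norm u) powr (\<alpha> - p) * A u powr p)) \<partial>lborel)
    \<le> ennreal (\<delta> powr (- p))
      * (\<integral>\<^sup>+v. ennreal (indicator (ball 0 1) v * ((1 - norm v) powr \<alpha> * G v powr p)) \<partial>lborel)"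
proof -
  \<comment> \<open>Origin of \<open>\<delta>\<close>: a splitting weight (1 - t * |u|)^(e - 1)
    would lead to the constant e^(1 - p) / (p * \<delta> - (p - 1) * e), which is smallest at e =
    \<delta>, with value \<delta>^(-p). The two identities give the exponents left over from
    Jensen's inequality with this choice.\<close>
  have \<delta>: "\<delta> > 0" and exps: "(1 - \<delta>) * (p - 1) = \<alpha> + \<delta>" "\<alpha> - p + \<delta> * (p - 1) = - \<delta> - 1"
    using p by (auto simp: \<delta>_def field_simps)
  have [measurable]: "ball (0::'a) 1 \<in> sets borel" by simp
  \<comment> \<open>The joint integrand in the variable \<open>v = t *\<^sub>R u\<close>;
    \<open>norm v / t\<close> stands for \<open>norm u\<close>.\<close>
  define \<Phi> where "\<Phi> = (\<lambda>t (v::'a). indicator {1..} t * (indicator (ball 0 1) v *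
    ((1 - norm v / t) powr (- \<delta> - 1) * (norm v / t) * (G v powr p * (1 - norm v) powr (\<alpha> + \<delta>)))) :: real)"
  have \<Phi>_nonneg: "\<Phi> t v \<ge> 0" for t v
    by (auto simp: \<Phi>_def indicator_def)
  have [measurable]: "(\<lambda>(t, v). \<Phi> t v) \<in> borel_measurable (borel \<Otimes>\<^sub>M borel)"
    unfolding \<Phi>_def by measurable
  have [measurable]: "\<Phi> t \<in> borel_measurable borel" for t
    by measurable
  have pointwise: "ennreal (indicator (ball 0 1) u * ((1 - norm u) powr (\<alpha> - p) * A u powr p))
      \<le> ennreal (\<delta> powr (1 - p)) * (\<integral>\<^sup>+t. ennreal (\<Phi> t (t *\<^sub>R u)) \<partial>lborel)" if "u \<noteq> 0" for u
  proof (cases "norm u < 1")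
    case True
    define a where "a = norm u"
    have a: "0 < a" "a < 1" using True that by (auto simp: a_def)
    define W where "W = (1 - a) powr \<delta> / \<delta>"
    have W: "W > 0" using a \<delta> by (simp add: W_def)
    \<comment> \<open>The powers of \<open>1 - t * a\<close> in \<open>X\<close> and
      \<open>w\<close> cancel in the product \<open>X * w\<close>, but not in
      \<open>X powr p * w\<close>.\<close>
    define X where "X = (\<lambda>t. G (t *\<^sub>R u) * (1 - t * a) powr (1 - \<delta>))"
    define w where "w = (\<lambda>t. indicator {1..<1 / a} t * (a * (1 - t * a) powr (\<delta> - 1)) :: real)"
    have ta: "1 - t * a > 0" if "t \<in> {1..<1 / a}" for t
      using that a by (simp add: field_simps)
    have Xw: "X t * w t = indicator {1..<1 / a} t * (a * G (t *\<^sub>R u))" for t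
    proof (cases "t \<in> {1..<1 / a}")
      case True
      have "(1 - t * a) powr (1 - \<delta>) * (1 - t * a) powr (\<delta> - 1) = 1"
        using ta [OF True] by (simp flip: powr_add)
      then show ?thesis using True by (simp add: X_def w_def)
    qed (simp add: w_def)
    have "ennreal (A u powr p) \<le> ennreal (W powr (p - 1)) * (\<integral>\<^sup>+t. ennreal (X t powr p * w t) \<partial>lborel)"
    proof (rule jensen_powr_bound)
      show "ennreal (A u) \<le> (\<integral>\<^sup>+t. ennreal (X t * w t) \<partial>lborel)"
        unfolding Xw using A_le [of u] a by (simp add: a_def)
      show "(\<integral>\<^sup>+t. ennreal (w t) \<partial>lborel) \<le> ennreal W"
        unfolding w_def W_def by (rule nn_integral_powr_one_minus [OF a \<delta>])
      show "A u \<ge> 0" using A [of u] a by (simp add: a_def)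
      show "X \<in> borel_measurable lborel" "w \<in> borel_measurable lborel"
        unfolding X_def w_def by measurable
      show "X t \<ge> 0" "w t \<ge> 0" for t
        using G_nonneg a by (auto simp: X_def w_def indicator_def)
    qed (use p W in auto)
    then have "ennreal ((1 - a) powr (\<alpha> - p)) * ennreal (A u powr p) \<le> ennreal ((1 - a) powr (\<alpha> - p)) *
        (ennreal (W powr (p - 1)) * (\<integral>\<^sup>+t. ennreal (X t powr p * w t) \<partial>lborel))"
      by (intro mult_left_mono) auto
    also have "\<dots> = ennreal (\<delta> powr (1 - p)) *
        (ennreal ((1 - a) powr (- \<delta> - 1)) * (\<integral>\<^sup>+t. ennreal (X t powr p * w t) \<partial>lborel))"
    proof -
      have "(1 - a) powr (\<alpha> - p) * W powr (p - 1)
          = (1 - a) powr (\<alpha> - p) * (1 - a) powr (\<delta> * (p - 1)) * \<delta> powr (1 - p)"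
        using a \<delta> powr_minus_divide [of \<delta> "p - 1"] by (simp add: W_def powr_divide powr_powr)
      also have "\<dots> = \<delta> powr (1 - p) * (1 - a) powr (- \<delta> - 1)"
        by (simp add: exps flip: powr_add)
      finally show ?thesis
        by (simp add: ennreal_mult' flip: mult.assoc) (simp flip: ennreal_mult')
    qed
    also have "ennreal ((1 - a) powr (- \<delta> - 1)) * (\<integral>\<^sup>+t. ennreal (X t powr p * w t) \<partial>lborel)
        = (\<integral>\<^sup>+t. ennreal ((1 - a) powr (- \<delta> - 1)) * ennreal (X t powr p * w t) \<partial>lborel)"
      unfolding X_def w_def by (rule nn_integral_cmult [symmetric]) measurable
    also have "\<dots> = (\<integral>\<^sup>+t. ennreal (\<Phi> t (t *\<^sub>R u)) \<partial>lborel)"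
    proof (intro nn_integral_cong)
      fix t
      have "(1 - a) powr (- \<delta> - 1) * (X t powr p * w t) = \<Phi> t (t *\<^sub>R u)"
      proof (cases "t \<in> {1..<1 / a}")
        case True
        have ball: "t *\<^sub>R u \<in> ball 0 1" and t: "t \<ge> 1"
          using True ta [OF True] by (auto simp: a_def)
        have "X t powr p * (1 - t * a) powr (\<delta> - 1)
            = G (t *\<^sub>R u) powr p * ((1 - t * a) powr ((1 - \<delta>) * p) * (1 - t * a) powr (\<delta> - 1))"
          using ta [OF True] G_nonneg by (simp add: X_def powr_mult powr_powr)
        also have "(1 - t * a) powr ((1 - \<delta>) * p) * (1 - t * a) powr (\<delta> - 1)
            = (1 - t * a) powr (\<alpha> + \<delta>)"
          unfolding exps(1) [symmetric] powr_add [symmetric] by (simp add: algebra_simps)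
        finally show ?thesis
          using True ball t by (simp add: w_def \<Phi>_def a_def [symmetric])
      next
        case False
        then have "t < 1 \<or> t *\<^sub>R u \<notin> ball 0 1"
          using a by (auto simp: a_def [symmetric] field_simps)
        then show ?thesis
          using False by (auto simp: w_def \<Phi>_def)
      qed
      then show "ennreal ((1 - a) powr (- \<delta> - 1)) * ennreal (X t powr p * w t) = ennreal (\<Phi> t (t *\<^sub>R u))"
        by (simp flip: ennreal_mult')
    qed
    finally show ?thesis
      using True by (simp add: a_def ennreal_mult')
  qed simp
  \<comment> \<open>\<open>pointwise\<close> omits the origin, whose dilations do not trace a ray;
    it is a null set.\<close>
  have "(\<integral>\<^sup>+u. ennreal (indicator (ball 0 1) u * ((1 - norm u) powr (\<alpha> - p) * A u powr p)) \<partial>lborel)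
      \<le> (\<integral>\<^sup>+u. ennreal (\<delta> powr (1 - p)) * (\<integral>\<^sup>+t. ennreal (\<Phi> t (t *\<^sub>R u)) \<partial>lborel) \<partial>lborel)"
    using AE_lborel_singleton [of "0::'a"]
    by (intro nn_integral_mono_AE) (auto intro!: pointwise elim!: eventually_mono)
  also have "\<dots> = ennreal (\<delta> powr (1 - p)) * (\<integral>\<^sup>+u. (\<integral>\<^sup>+t. ennreal (\<Phi> t (t *\<^sub>R u)) \<partial>lborel) \<partial>lborel)"
    by (intro nn_integral_cmult) measurable
  also have "(\<integral>\<^sup>+u. (\<integral>\<^sup>+t. ennreal (\<Phi> t (t *\<^sub>R u)) \<partial>lborel) \<partial>lborel)
      = (\<integral>\<^sup>+t. (\<integral>\<^sup>+u. ennreal (\<Phi> t (t *\<^sub>R u)) \<partial>lborel) \<partial>lborel)"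
    by (rule lborel_pair.Fubini') measurable
  also have "\<dots> \<le> (\<integral>\<^sup>+t. (\<integral>\<^sup>+v. ennreal (1 / t * \<Phi> t v) \<partial>lborel) \<partial>lborel)"
  proof (rule nn_integral_mono)
    fix t :: real
    show "(\<integral>\<^sup>+u. ennreal (\<Phi> t (t *\<^sub>R u)) \<partial>lborel) \<le> (\<integral>\<^sup>+v. ennreal (1 / t * \<Phi> t v) \<partial>lborel)"
    proof (cases "t \<ge> 1")
      case True
      \<comment> \<open>The Jacobian \<open>1 / t ^ DIM('a)\<close> is weakened to
        \<open>1 / t\<close>: together with the factor \<open>norm v / t\<close> of
        \<open>\<Phi>\<close> this makes \<open>norm v / t\<^sup>2\<close>, the exact derivative of
        \<open>1 - norm v / t\<close>.\<close>
      have "t ^ 1 \<le> t ^ DIM('a)"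
        by (rule power_increasing) (use True in auto)
      then have d: "1 / t ^ DIM('a) \<le> 1 / t"
        using True by (simp add: frac_le)
      have "(\<integral>\<^sup>+u. ennreal (\<Phi> t (t *\<^sub>R u)) \<partial>lborel) = ennreal (1 / t ^ DIM('a)) * (\<integral>\<^sup>+v. ennreal (\<Phi> t v) \<partial>lborel)"
        using True by (intro nn_integral_scaleR) auto
      also have "\<dots> \<le> ennreal (1 / t) * (\<integral>\<^sup>+v. ennreal (\<Phi> t v) \<partial>lborel)"
        by (intro mult_right_mono ennreal_leI d) auto
      also have "\<dots> = (\<integral>\<^sup>+v. ennreal (1 / t * \<Phi> t v) \<partial>lborel)"
        using True \<Phi>_nonneg by (subst nn_integral_cmult [symmetric]) (auto simp flip: ennreal_mult)
      finally show ?thesis .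
    qed (simp add: \<Phi>_def)
  qed
  also have "\<dots> = (\<integral>\<^sup>+v. (\<integral>\<^sup>+t. ennreal (1 / t * \<Phi> t v) \<partial>lborel) \<partial>lborel)"
    by (rule lborel_pair.Fubini') measurable
  also have "\<dots> \<le> (\<integral>\<^sup>+v. ennreal (1 / \<delta>) *
      ennreal (indicator (ball 0 1) v * ((1 - norm v) powr \<alpha> * G v powr p)) \<partial>lborel)"
  proof (intro nn_integral_mono)
    fix v :: 'a
    show "(\<integral>\<^sup>+t. ennreal (1 / t * \<Phi> t v) \<partial>lborel)
      \<le> ennreal (1 / \<delta>) * ennreal (indicator (ball 0 1) v * ((1 - norm v) powr \<alpha> * G v powr p))"
    proof (cases "v \<in> ball 0 1")
      case True
      then have v: "norm v < 1" by simp
      define C where "C = G v powr p * (1 - norm v) powr (\<alpha> + \<delta>)"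
      have C: "C \<ge> 0" by (simp add: C_def)
      have "(\<integral>\<^sup>+t. ennreal (1 / t * \<Phi> t v) \<partial>lborel) = (\<integral>\<^sup>+t. ennreal C *
          ennreal (indicator {1..} t * (norm v / t\<^sup>2 * (1 - norm v / t) powr (- \<delta> - 1))) \<partial>lborel)"
        using C True by (intro nn_integral_cong, subst ennreal_mult' [symmetric])
          (auto simp: \<Phi>_def C_def power2_eq_square indicator_def)
      also have "\<dots> = ennreal C * (\<integral>\<^sup>+t.
          ennreal (indicator {1..} t * (norm v / t\<^sup>2 * (1 - norm v / t) powr (- \<delta> - 1))) \<partial>lborel)"
        by (intro nn_integral_cmult) measurable
      also have "\<dots> \<le> ennreal C * ennreal ((1 - norm v) powr (- \<delta>) / \<delta>)"
        by (intro mult_left_mono nn_integral_inverse_square v \<delta>) auto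
      also have "\<dots> = ennreal (C * ((1 - norm v) powr (- \<delta>) / \<delta>))"
        by (rule ennreal_mult' [symmetric, OF C])
      also have "C * ((1 - norm v) powr (- \<delta>) / \<delta>) = 1 / \<delta> * (1 * ((1 - norm v) powr \<alpha> * G v powr p))"
        using v by (simp add: C_def powr_add powr_minus field_simps)
      also have "ennreal \<dots> = ennreal (1 / \<delta>) * ennreal (1 * ((1 - norm v) powr \<alpha> * G v powr p))"
        using \<delta> by (intro ennreal_mult') simp
      finally show ?thesis
        using True by simp
    qed (simp add: \<Phi>_def)
  qed
  also have "\<dots> = ennreal (1 / \<delta>) *
      (\<integral>\<^sup>+v. ennreal (indicator (ball 0 1) v * ((1 - norm v) powr \<alpha> * G v powr p)) \<partial>lborel)"
    by (intro nn_integral_cmult) measurable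
  finally have "(\<integral>\<^sup>+u. ennreal (indicator (ball 0 1) u * ((1 - norm u) powr (\<alpha> - p) * A u powr p)) \<partial>lborel)
      \<le> ennreal (\<delta> powr (1 - p)) * (ennreal (1 / \<delta>) *
      (\<integral>\<^sup>+v. ennreal (indicator (ball 0 1) v * ((1 - norm v) powr \<alpha> * G v powr p)) \<partial>lborel))"
    by (simp add: mult_left_mono)
  also have "ennreal (\<delta> powr (1 - p)) * (ennreal (1 / \<delta>) * Z) = ennreal (\<delta> powr (- p)) * Z" for Z
    using \<delta> by (simp add: powr_diff powr_minus field_simps flip: mult.assoc ennreal_mult')
  finally show ?thesis .
qed

text \<open>The fundamental theorem of calculus along the ray from \<open>u\<close>, where
  \<open>t = 1\<close>, to the circle, where \<open>t = 1 / norm u\<close>.\<close>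

lemma radial_growth_le:
  assumes B: "B holomorphic_on S" "open S" "cball 0 1 \<subseteq> S" and u: "0 < norm u" "norm u < 1"
  shows "ennreal (norm (B (u / of_real (norm u))) - norm (B u))
    \<le> (\<integral>\<^sup>+t. ennreal (indicator {1..<1 / norm u} t * (norm u * norm (deriv B (t *\<^sub>R u)))) \<partial>lborel)"
proof -
  define a where "a = norm u"
  have a: "0 < a" "a < 1" using u by (auto simp: a_def)
  have in_S: "t *\<^sub>R u \<in> S" if "t \<in> {1..1 / a}" for t
  proof -
    have "norm (t *\<^sub>R u) \<le> 1"
      using that a by (auto simp: a_def [symmetric] field_simps)
    then show ?thesis using B(3) by auto
  qed
  have contB': "continuous_on {1..1 / a} (\<lambda>t. deriv B (t *\<^sub>R u))"
    using in_S by (intro continuous_on_compose2 [OF holomorphic_on_imp_continuous_on [OF holomorphic_deriv [OF B(1,2)]]]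
        continuous_intros) auto
  have "((\<lambda>t. u * deriv B (t *\<^sub>R u)) has_integral B ((1 / a) *\<^sub>R u) - B (1 *\<^sub>R u)) {1..1 / a}"
  proof (rule fundamental_theorem_of_calculus)
    show "1 \<le> 1 / a" using a by simp
    fix t assume t: "t \<in> {1..1 / a}"
    have 1: "((\<lambda>t. t *\<^sub>R u) has_vector_derivative u) (at t within {1..1 / a})"
      by (auto intro!: derivative_eq_intros)
    have 2: "(B has_field_derivative deriv B (t *\<^sub>R u)) (at (t *\<^sub>R u))"
      using in_S [OF t] B by (intro holomorphic_derivI) auto
    show "((\<lambda>t. B (t *\<^sub>R u)) has_vector_derivative u * deriv B (t *\<^sub>R u)) (at t within {1..1 / a})"
      using field_vector_diff_chain_within [OF 1 has_field_derivative_at_within [OF 2]]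
      by (simp add: comp_def)
  qed
  moreover have int: "(\<lambda>t. norm (u * deriv B (t *\<^sub>R u))) integrable_on {1..1 / a}"
    by (intro integrable_continuous_interval continuous_intros contB')
  ultimately have le: "norm (B ((1 / a) *\<^sub>R u) - B u) \<le> integral {1..1 / a} (\<lambda>t. norm (u * deriv B (t *\<^sub>R u)))"
    using integral_norm_bound_integral [of "\<lambda>t. u * deriv B (t *\<^sub>R u)" "{1..1 / a}"]
    by (fastforce simp: has_integral_iff)
  have "norm (B (u / of_real (norm u))) - norm (B u) \<le> norm (B ((1 / a) *\<^sub>R u) - B u)"
    using norm_triangle_ineq2 [of "B ((1 / a) *\<^sub>R u)" "B u"]
    by (simp add: a_def scaleR_conv_of_real divide_inverse mult.commute)
  with le have "ennreal (norm (B (u / of_real (norm u))) - norm (B u))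
      \<le> ennreal (integral {1..1 / a} (\<lambda>t. norm (u * deriv B (t *\<^sub>R u))))"
    by (intro ennreal_leI) simp
  also have "\<dots> = (\<integral>\<^sup>+t. ennreal (norm (u * deriv B (t *\<^sub>R u))) * indicator {1..1 / a} t \<partial>lborel)"
    using int by (intro nn_integral_has_integral_lebesgue' [symmetric]) auto
  \<comment> \<open>Dropping the endpoint, a null set, keeps \<open>t *\<^sub>R u\<close> in the
    open disc.\<close>
  also have "\<dots> \<le> (\<integral>\<^sup>+t. ennreal (indicator {1..<1 / a} t * (norm u * norm (deriv B (t *\<^sub>R u)))) \<partial>lborel)"
    using AE_lborel_singleton [of "1 / a"]
    by (intro nn_integral_mono_AE) (auto elim!: eventually_mono simp: indicator_def norm_mult)
  finally show ?thesis by (simp add: a_def)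
qed

section \<open>Roots, constants and weights in the Bergman norms\<close>

lemma ennreal_powr_inverse_le:
  assumes "x \<le> ennreal (C powr p) * y" "C \<ge> 0" "p > 0"
  shows "ennreal_powr x (1 / p) \<le> ennreal C * ennreal_powr y (1 / p)"
proof (cases y)
  case y: (real r)
  then have "x \<le> ennreal (C powr p * r)"
    using assms(1) by (simp add: ennreal_mult)
  then obtain s where s: "x = ennreal s" "s \<ge> 0" "s \<le> C powr p * r"
    by (cases x) (auto simp: top_unique y)
  have "s powr (1 / p) \<le> (C powr p * r) powr (1 / p)"
    using s assms by (intro powr_mono2) auto
  also have "\<dots> = C * r powr (1 / p)"
    using assms y by (simp add: powr_mult powr_powr)
  finally show ?thesis
    using s y assms by (simp add: ennreal_powr_def ennreal_leI flip: ennreal_mult)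
next
  case top
  show ?thesis
  proof (cases "C = 0")
    \<comment> \<open>\<open>0 * top = 0\<close> in \<open>ennreal\<close>, so the hypothesis
      already forces \<open>x = 0\<close>.\<close>
    case True
    then have "x = 0" using assms by simp
    then show ?thesis by (simp add: ennreal_powr_def)
  next
    case False
    then show ?thesis using top assms(2) by (simp add: ennreal_powr_def ennreal_mult_top)
  qed
qed

lemma bergman_norm_le:
  assumes "(\<integral>\<^sup>+u \<in> ball 0 1. ennreal ((1 - (norm u)\<^sup>2) powr \<alpha> * norm (h u) powr p) \<partial>lborel)
      \<le> ennreal (C powr p) * (\<integral>\<^sup>+u \<in> ball 0 1. ennreal ((1 - (norm u)\<^sup>2) powr \<alpha> * norm (k u) powr p) \<partial>lborel)"
    and "C \<ge> 0" "p > 0"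
  shows "bergman_norm p \<alpha> h \<le> ennreal C * bergman_norm p \<alpha> k"
  unfolding bergman_norm_def
  using divide_right_mono_ennreal [OF assms(1), of "ennreal pi"]
  by (intro ennreal_powr_inverse_le assms) (simp add: ennreal_times_divide)

text \<open>The left-hand side collects the losses of the argument: \<open>2 powr p\<close> from 1 -
  |B|^2 \<le> 2 * (1 - |B|), the factor 2 from \<open>weight_comparison\<close>, and the constant of
  the Hardy inequality. The remaining factor of \<open>K_const p \<alpha> powr p\<close> has the
  form x / (x - 1) with x = 2^(1 / (\<alpha> + 1)) > 1, so it exceeds 1.\<close>

lemma K_const_powr_ge:
  assumes p: "p > 1" "p > 1 + \<alpha>" and \<alpha>: "\<alpha> > - 1"
  shows "2 * (2 powr p * ((p - 1 - \<alpha>) / p) powr (- p)) \<le> K_const p \<alpha> powr p" "K_const p \<alpha> \<ge> 0"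
proof -
  define q where "q = 2 powr (1 / (\<alpha> + 1)) / (2 powr (1 / (\<alpha> + 1)) - 1)"
  have "2 powr (1 / (\<alpha> + 1)) > (1::real)"
    using \<alpha> by (intro gr_one_powr) auto
  then have q: "q \<ge> 1" by (simp add: q_def)
  have "K_const p \<alpha> powr p = q * (p / (p - 1 - \<alpha>)) powr p * 2 powr (p + 1)"
    using p q by (simp add: K_const_def q_def [symmetric] powr_powr)
  also have "(p / (p - 1 - \<alpha>)) powr p = ((p - 1 - \<alpha>) / p) powr (- p)"
    using p by (simp add: powr_minus powr_divide)
  finally have K: "K_const p \<alpha> powr p = q * (((p - 1 - \<alpha>) / p) powr (- p) * 2 powr (p + 1))"
    by simp
  have "1 * (((p - 1 - \<alpha>) / p) powr (- p) * 2 powr (p + 1)) \<le> K_const p \<alpha> powr p"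
    unfolding K by (intro mult_right_mono q) auto
  then show "2 * (2 powr p * ((p - 1 - \<alpha>) / p) powr (- p)) \<le> K_const p \<alpha> powr p"
    by (simp add: powr_add mult.commute)
  show "K_const p \<alpha> \<ge> 0"
    by (simp add: K_const_def)
qed

text \<open>The two weights differ by (1 + r)^\<alpha> with 1 \<le> 1 + r < 2, and this is at least
  1/2 since \<alpha> > -1; the constant 2 thus serves all \<alpha> at once.\<close>

lemma weight_comparison:
  fixes r \<alpha> :: real
  assumes r: "0 \<le> r" "r < 1" and \<alpha>: "\<alpha> > - 1"
  shows "(1 - r) powr \<alpha> \<le> 2 * (1 - r\<^sup>2) powr \<alpha>"
proof -
  have "2 powr (- 1) \<le> (1 + r) powr \<alpha>"
  proof (cases "\<alpha> \<ge> 0")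
    case True
    then have "1 \<le> (1 + r) powr \<alpha>"
      using r powr_mono2 [of \<alpha> 1 "1 + r"] by simp
    then show ?thesis by (simp add: powr_minus)
  next
    case False
    have "2 powr (- 1) \<le> (2::real) powr \<alpha>"
      using \<alpha> by (intro powr_mono) auto
    also have "\<dots> \<le> (1 + r) powr \<alpha>"
      using r False by (intro powr_mono2') auto
    finally show ?thesis .
  qed
  then have "1 * (1 - r) powr \<alpha> \<le> 2 * (1 + r) powr \<alpha> * (1 - r) powr \<alpha>"
    by (intro mult_right_mono) (auto simp: powr_minus)
  also have "\<dots> = 2 * (1 - r\<^sup>2) powr \<alpha>"
    using r by (simp add: powr_mult [symmetric] power2_eq_square algebra_simps)
  finally show ?thesis by simp
qed

section \<open>The norm inequality\<close>

lemma norm_blaschke_product_le_1: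
  assumes l: "\<And>k. k \<in> {1..n} \<Longrightarrow> norm (l k) < 1" and z: "norm z < 1"
  shows "norm (blaschke_product n l z) \<le> 1"
proof -
  have "norm (blaschke_factor (l k) z) \<le> 1" if "k \<in> {1..n}" for k
  proof -
    have "blaschke_factor (l k) z = - Moebius_function 0 (l k) z"
      by (simp add: blaschke_factor_def Moebius_function_def minus_divide_left)
    then show ?thesis
      using Moebius_function_norm_lt_1 [OF l [OF that] z, of 0] by simp
  qed
  then show ?thesis
    unfolding blaschke_product_def prod_norm [symmetric] by (intro prod_le_1) auto
qed

text \<open>Each admissible \<open>g\<close> yields the estimate with its own sup norm while the
  other quantities stay fixed, so the infimum may be taken. \<open>F\<close> itself is admissible by
  Cauchy's formula; hence the BMOA norm is finite and \<open>enn2real\<close> loses nothing.\<close>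

lemma deriv_rational_le_bmoa:
  assumes f: "f \<in> ratfuns_plus n" "reflected_poles f n l"
    and l: "\<And>k. k \<in> {1..n} \<Longrightarrow> norm (l k) < 1"
  shows "bmoa_norm f < top"
    and "norm \<xi> < 1 \<Longrightarrow> norm (deriv f \<xi>) * (1 - (norm \<xi>)\<^sup>2)
      \<le> enn2real (bmoa_norm f) * (1 - (norm (blaschke_product n l \<xi>))\<^sup>2)"
proof -
  obtain P where P: "degree P \<le> n"
    and fP: "\<And>z. norm z \<le> 1 \<Longrightarrow> f z = poly P z / (\<Prod>k=1..n. 1 - cnj (l k) * z)"
    using ratfuns_plus_reflected_poles [OF f] by blast
  define F where "F = (\<lambda>z. poly P z / (\<Prod>k=1..n. 1 - cnj (l k) * z))"
  obtain R where R: "R > 1" and nz: "\<And>k z. k \<in> {1..n} \<Longrightarrow> z \<in> ball 0 R \<Longrightarrow> 1 - cnj (l k) * z \<noteq> 0"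
    by (rule norm_lt_1_imp_radius [of "(cnj \<circ> l) ` {1..n}"]) (use l in auto)
  have holF: "F holomorphic_on ball 0 R"
    unfolding F_def using nz by (intro holomorphic_poly_over_prod) auto
  have contF: "continuous_on (cball 0 1) F" and holF1: "F holomorphic_on ball 0 1"
    using R by (auto intro!: holomorphic_on_imp_continuous_on holomorphic_on_subset [OF holF])
  have cFu: "continuous_on {0..1} (\<lambda>t. F (ucirc t))"
    by (rule continuous_on_compose2 [OF contF continuous_on_ucirc]) auto
  \<comment> \<open>\<open>f\<close> and \<open>F\<close> are only known to agree on the closed
    disc; for the derivative a neighbourhood of \<open>\<xi>\<close> is enough.\<close>
  have dF: "deriv f \<xi> = deriv F \<xi>" if "norm \<xi> < 1" for \<xi>
  proof (rule deriv_cong_ev)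
    have "\<forall>\<^sub>F z in nhds \<xi>. z \<in> ball 0 1"
      using that by (intro eventually_nhds_in_open) auto
    then show "\<forall>\<^sub>F z in nhds \<xi>. f z = F z"
      by eventually_elim (simp add: fP F_def)
  qed simp
  define A where "A = {g \<in> circle_Linf. \<forall>\<xi> \<in> ball 0 1.
     f \<xi> = 1 / (2 * of_real pi * \<i>) * contour_integral (circlepath 0 1) (\<lambda>u. g u / (u - \<xi>))}"
  have FA: "F \<in> A"
  proof -
    obtain C where C: "\<And>t. t \<in> {0..1} \<Longrightarrow> norm (F (ucirc t)) \<le> C"
      using compact_imp_bounded [OF compact_continuous_image [OF cFu compact_Icc]]
      unfolding bounded_iff by (metis imageI)
    have meas: "(\<lambda>t. F (ucirc t)) \<in> borel_measurable unit_leb"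
      by (intro continuous_measurable_unit_leb cFu)
    have "circle_Linf_norm F \<le> ennreal C"
      unfolding circle_Linf_norm_def using C meas
      by (intro esssup_I AE_I2 ennreal_leI) (auto simp: space_restrict_space)
    then have "F \<in> circle_Linf"
      using meas by (auto simp: circle_Linf_def intro: le_less_trans)
    moreover have "f \<xi> = 1 / (2 * of_real pi * \<i>) * contour_integral (circlepath 0 1) (\<lambda>u. F u / (u - \<xi>))"
      if "norm \<xi> < 1" for \<xi>
      using contour_integral_unique [OF Cauchy_integral_circlepath [of 0 1 F \<xi>]] contF holF1 that
      by (simp add: fP F_def)
    ultimately show ?thesis by (simp add: A_def)
  qed
  have bmoa: "bmoa_norm f = Inf (circle_Linf_norm ` A)"
    by (simp add: bmoa_norm_def A_def)
  have "bmoa_norm f \<le> circle_Linf_norm F"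
    unfolding bmoa using FA by (intro Inf_lower) auto
  also have "circle_Linf_norm F < top"
    using FA by (simp add: A_def circle_Linf_def)
  finally show fin: "bmoa_norm f < top" .
  assume \<xi>: "norm \<xi> < 1"
  define X where "X = norm (deriv f \<xi>) * (1 - (norm \<xi>)\<^sup>2)"
  define Y where "Y = 1 - (norm (blaschke_product n l \<xi>))\<^sup>2"
  have Y: "Y \<ge> 0"
    using norm_blaschke_product_le_1 [OF l \<xi>] by (simp add: Y_def abs_square_le_1)
  have key: "X \<le> enn2real (circle_Linf_norm g) * Y" if g: "g \<in> A" for g
  proof -
    define G where "G = (\<lambda>t. g (ucirc t))"
    define M where "M = enn2real (circle_Linf_norm g)"
    have G: "G \<in> borel_measurable unit_leb"
      using g by (simp add: A_def circle_Linf_def G_def)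
    have Mg: "circle_Linf_norm g = ennreal M"
      using g by (simp add: A_def circle_Linf_def M_def less_top)
    have "AE t in unit_leb. ennreal (norm (G t)) \<le> ennreal M"
      unfolding Mg [symmetric] circle_Linf_norm_def G_def by (rule esssup_AE)
    then have GM: "AE t in unit_leb. norm (G t) \<le> M"
      by eventually_elim (simp add: M_def)
    have "norm (deriv F \<xi>) * (1 - (norm \<xi>)\<^sup>2) \<le> M * (1 - (norm (blaschke_product n l \<xi>))\<^sup>2)"
      unfolding F_def
    proof (rule deriv_rational_le [OF P l G GM _ \<xi>])
      fix w :: complex assume w: "norm w < 1"
      have "continuous_on {0..1} (\<lambda>t. ucirc t / (ucirc t - w))"
        using norm_lt_1_neq_ucirc(1) [OF w] by (intro continuous_intros) auto
      from integrable_bounded_mult_continuous [OF G GM this]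
      have "integrable unit_leb (\<lambda>t. g (ucirc t) / (ucirc t - w) * ucirc t)"
        by (simp add: G_def)
      from contour_integral_ucirc [of "\<lambda>u. g u / (u - w)", OF this]
      show "(\<integral>t. G t / (ucirc t - w) * ucirc t \<partial>unit_leb) = poly P w / (\<Prod>k=1..n. 1 - cnj (l k) * w)"
        using g w fP [of w] by (simp add: A_def G_def)
    qed
    then show ?thesis
      using dF [OF \<xi>] by (simp add: X_def Y_def M_def)
  qed
  \<comment> \<open>Dividing by \<open>Y\<close> isolates the sup norm, over which the infimum runs.
    The case \<open>Y = 0\<close>, as for the empty product, is settled by the single function
    \<open>F\<close>.\<close>
  have "X \<le> enn2real (bmoa_norm f) * Y"
  proof (cases "Y = 0")
    case True
    then show ?thesis using key [OF FA] by simp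
  next
    case False
    with Y have Y: "Y > 0" by simp
    have "ennreal (X / Y) \<le> bmoa_norm f"
      unfolding bmoa
    proof (intro Inf_greatest, clarify)
      fix g assume g: "g \<in> A"
      then have "circle_Linf_norm g = ennreal (enn2real (circle_Linf_norm g))"
        by (simp add: A_def circle_Linf_def less_top)
      moreover have "X / Y \<le> enn2real (circle_Linf_norm g)"
        using key [OF g] Y by (simp add: field_simps)
      ultimately show "ennreal (X / Y) \<le> circle_Linf_norm g"
        by (metis ennreal_leI)
    qed
    also have "bmoa_norm f = ennreal (enn2real (bmoa_norm f))"
      using fin by (simp add: less_top)
    finally have "X / Y \<le> enn2real (bmoa_norm f)"
      by (simp add: ennreal_le_iff)
    then show ?thesis using Y by (simp add: field_simps)
  qed
  then show "norm (deriv f \<xi>) * (1 - (norm \<xi>)\<^sup>2)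
      \<le> enn2real (bmoa_norm f) * (1 - (norm (blaschke_product n l \<xi>))\<^sup>2)"
    by (simp add: X_def Y_def)
qed

text \<open>In the exponent \<open>\<alpha> - p\<close> the first term is the Bergman weight, and
  \<open>- p\<close> comes from dividing the derivative estimate by 1 - |u|^2 before taking p-th
  powers. The factor 2 pays for returning from 1 - |v| to 1 - |v|^2.\<close>

lemma blaschke_radial_Hardy:
  fixes n :: nat and l :: "nat \<Rightarrow> complex" and p \<alpha> :: real
  defines "B \<equiv> blaschke_product n l"
  assumes l: "\<And>k. k \<in> {1..n} \<Longrightarrow> norm (l k) < 1"
    and \<alpha>: "\<alpha> > - 1" and p: "1 < p" "p > 1 + \<alpha>"
  shows "(\<integral>\<^sup>+u \<in> ball 0 1. ennreal ((1 - norm u) powr (\<alpha> - p) * (1 - norm (B u)) powr p) \<partial>lborel)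
    \<le> ennreal (2 * ((p - 1 - \<alpha>) / p) powr (- p)) *
      (\<integral>\<^sup>+u \<in> ball 0 1. ennreal ((1 - (norm u)\<^sup>2) powr \<alpha> * norm (deriv B u) powr p) \<partial>lborel)"
proof -
  define \<delta> where "\<delta> = (p - 1 - \<alpha>) / p"
  obtain R where R: "R > 1" and nz: "\<And>k z. k \<in> {1..n} \<Longrightarrow> z \<in> ball 0 R \<Longrightarrow> 1 - cnj (l k) * z \<noteq> 0"
    by (rule norm_lt_1_imp_radius [of "(cnj \<circ> l) ` {1..n}"]) (use l in auto)
  have holB: "B holomorphic_on ball 0 R"
    unfolding B_def using nz by (intro holomorphic_intros) auto
  \<comment> \<open>The cut-off makes \<open>G\<close> Borel on the whole plane. It changes nothing
    along the rays, since the half-open range of \<open>t\<close> in \<open>radial_growth_le\<close>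
    stays inside the disc.\<close>
  define G where "G = (\<lambda>v. indicator (ball 0 1) v * norm (deriv B v))"
  have [measurable]: "ball (0::complex) 1 \<in> sets borel" by simp
  have "continuous_on (ball 0 1) (\<lambda>v. norm (deriv B v))"
    using R by (intro continuous_intros holomorphic_on_imp_continuous_on
        holomorphic_on_subset [OF holomorphic_deriv [OF holB]]) auto
  then have G [measurable]: "G \<in> borel_measurable borel"
    using borel_measurable_continuous_on_indicator [of "ball 0 1" "\<lambda>v. norm (deriv B v)"]
    by (simp add: G_def)
  have "(\<integral>\<^sup>+u \<in> ball 0 1. ennreal ((1 - norm u) powr (\<alpha> - p) * (1 - norm (B u)) powr p) \<partial>lborel)
      = (\<integral>\<^sup>+u. ennreal (indicator (ball 0 1) u * ((1 - norm u) powr (\<alpha> - p) * (1 - norm (B u)) powr p)) \<partial>lborel)"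
    by (intro nn_integral_cong) (auto simp: indicator_def)
  also have "\<dots> \<le> ennreal (\<delta> powr (- p))
      * (\<integral>\<^sup>+v. ennreal (indicator (ball 0 1) v * ((1 - norm v) powr \<alpha> * G v powr p)) \<partial>lborel)"
    unfolding \<delta>_def
  proof (rule radial_Hardy_inequality [OF p G])
    show "G v \<ge> 0" for v by (simp add: G_def)
    fix u :: complex assume u: "0 < norm u" "norm u < 1"
    show "1 - norm (B u) \<ge> 0"
      unfolding B_def using norm_blaschke_product_le_1 [OF l u(2)] by simp
    have "norm (B (u / of_real (norm u))) = 1"
      unfolding B_def using l u by (intro norm_blaschke_product_eq_1) (auto simp: norm_divide)
    then have "ennreal (1 - norm (B u))
        \<le> (\<integral>\<^sup>+t. ennreal (indicator {1..<1 / norm u} t * (norm u * norm (deriv B (t *\<^sub>R u)))) \<partial>lborel)"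
      using radial_growth_le [OF holB _ _ u] R by (simp add: cball_subset_ball_iff)
    also have "\<dots> = (\<integral>\<^sup>+t. ennreal (indicator {1..<1 / norm u} t * (norm u * G (t *\<^sub>R u))) \<partial>lborel)"
      using u by (intro nn_integral_cong) (auto simp: indicator_def G_def field_simps)
    finally show "ennreal (1 - norm (B u)) \<le> \<dots>" .
  qed
  also have "(\<integral>\<^sup>+v. ennreal (indicator (ball 0 1) v * ((1 - norm v) powr \<alpha> * G v powr p)) \<partial>lborel)
      \<le> (\<integral>\<^sup>+v. ennreal 2 * (ennreal (indicator (ball 0 1) v * ((1 - (norm v)\<^sup>2) powr \<alpha> * G v powr p))) \<partial>lborel)"
  proof (intro nn_integral_mono)
    fix v :: complex
    have "indicator (ball 0 1) v * ((1 - norm v) powr \<alpha> * G v powr p)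
        \<le> 2 * (indicator (ball 0 1) v * ((1 - (norm v)\<^sup>2) powr \<alpha> * G v powr p))"
    proof (cases "norm v < 1")
      case True
      have "(1 - norm v) powr \<alpha> * G v powr p \<le> 2 * (1 - (norm v)\<^sup>2) powr \<alpha> * G v powr p"
        by (intro mult_right_mono weight_comparison True \<alpha>) auto
      then show ?thesis using True by simp
    qed simp
    then show "ennreal (indicator (ball 0 1) v * ((1 - norm v) powr \<alpha> * G v powr p))
        \<le> ennreal 2 * (ennreal (indicator (ball 0 1) v * ((1 - (norm v)\<^sup>2) powr \<alpha> * G v powr p)))"
      by (subst ennreal_mult' [symmetric]) (auto intro: ennreal_leI)
  qed
  also have "\<dots> = ennreal 2 * (\<integral>\<^sup>+v. ennreal (indicator (ball 0 1) v * ((1 - (norm v)\<^sup>2) powr \<alpha> * G v powr p)) \<partial>lborel)"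
    by (intro nn_integral_cmult) measurable
  also have "(\<integral>\<^sup>+v. ennreal (indicator (ball 0 1) v * ((1 - (norm v)\<^sup>2) powr \<alpha> * G v powr p)) \<partial>lborel)
      = (\<integral>\<^sup>+u \<in> ball 0 1. ennreal ((1 - (norm u)\<^sup>2) powr \<alpha> * norm (deriv B u) powr p) \<partial>lborel)"
    by (intro nn_integral_cong) (auto simp: indicator_def G_def)
  finally have "(\<integral>\<^sup>+u \<in> ball 0 1. ennreal ((1 - norm u) powr (\<alpha> - p) * (1 - norm (B u)) powr p) \<partial>lborel)
    \<le> ennreal (\<delta> powr (- p)) * (ennreal 2 *
      (\<integral>\<^sup>+u \<in> ball 0 1. ennreal ((1 - (norm u)\<^sup>2) powr \<alpha> * norm (deriv B u) powr p) \<partial>lborel))"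
    by (simp add: mult_left_mono)
  also have "ennreal (\<delta> powr (- p)) * (ennreal 2 * Z) = ennreal (2 * \<delta> powr (- p)) * Z" for Z
    by (simp add: ennreal_mult' mult_ac)
  finally show ?thesis by (simp only: \<delta>_def)
qed

theorem theorem2p3:
  fixes n :: nat and f :: "complex \<Rightarrow> complex" and l :: "nat \<Rightarrow> complex" and p \<alpha> :: real
  assumes "n \<ge> 1"
    and "f \<in> ratfuns_plus n"
    and "rat_degree f = n"
    and "\<And>k. k \<in> {1..n} \<Longrightarrow> l k \<in> ball 0 1"
    and "reflected_poles f n l"
    and "\<alpha> > - 1"
    and "1 < p"
    and "p > 1 + \<alpha>"
  shows "bergman_norm p \<alpha> (deriv f)
           \<le> ennreal (K_const p \<alpha>) * bmoa_norm f * bergman_norm p \<alpha> (deriv (blaschke_product n l))"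
proof -
  define B where "B = blaschke_product n l"
  define N where "N = enn2real (bmoa_norm f)"
  define I where "I = (\<integral>\<^sup>+u \<in> ball 0 1. ennreal ((1 - (norm u)\<^sup>2) powr \<alpha> * norm (deriv B u) powr p) \<partial>lborel)"
  have l: "norm (l k) < 1" if "k \<in> {1..n}" for k
    using assms(4) [OF that] by simp
  have bmoa: "bmoa_norm f = ennreal N"
    using deriv_rational_le_bmoa(1) [OF assms(2,5) l] by (simp add: N_def less_top)
  have N: "N \<ge> 0" by (simp add: N_def)
  have K: "2 * (2 powr p * ((p - 1 - \<alpha>) / p) powr (- p)) \<le> K_const p \<alpha> powr p" "K_const p \<alpha> \<ge> 0"
    by (rule K_const_powr_ge [OF assms(7,8,6)])+
  have pointwise: "(1 - (norm u)\<^sup>2) powr \<alpha> * norm (deriv f u) powr p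
      \<le> (2 * N) powr p * ((1 - norm u) powr (\<alpha> - p) * (1 - norm (B u)) powr p)" if u: "norm u < 1" for u
  proof -
    have B1: "norm (B u) \<le> 1"
      unfolding B_def by (rule norm_blaschke_product_le_1 [OF l u])
    have w: "1 - (norm u)\<^sup>2 > 0" using u by (simp add: power_less_one_iff)
    have w': "1 - (norm u)\<^sup>2 \<ge> 1 - norm u"
      using u by (simp add: power2_eq_square mult_left_le)
    \<comment> \<open>The factor 2 lost here becomes \<open>2 powr p\<close> in the
      constant.\<close>
    have "1 - (norm (B u))\<^sup>2 = (1 + norm (B u)) * (1 - norm (B u))"
      by (simp add: power2_eq_square algebra_simps)
    also have "\<dots> \<le> 2 * (1 - norm (B u))"
      using B1 by (intro mult_right_mono) auto
    finally have "N * (1 - (norm (B u))\<^sup>2) \<le> N * (2 * (1 - norm (B u)))"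
      using N by (intro mult_left_mono)
    with deriv_rational_le_bmoa(2) [OF assms(2,5) l u]
    have *: "norm (deriv f u) * (1 - (norm u)\<^sup>2) \<le> (2 * N) * (1 - norm (B u))"
      by (simp add: N_def B_def algebra_simps)
    have "(1 - (norm u)\<^sup>2) powr \<alpha> * norm (deriv f u) powr p
        = (1 - (norm u)\<^sup>2) powr (\<alpha> - p) * (norm (deriv f u) * (1 - (norm u)\<^sup>2)) powr p"
      using w by (simp add: powr_mult powr_diff)
    also have "\<dots> \<le> (1 - norm u) powr (\<alpha> - p) * ((2 * N) * (1 - norm (B u))) powr p"
    proof (intro mult_mono)
      \<comment> \<open>\<open>\<alpha> - p\<close> is negative, so passing to the smaller base 1 -
        |u| increases the power.\<close>
      show "(1 - (norm u)\<^sup>2) powr (\<alpha> - p) \<le> (1 - norm u) powr (\<alpha> - p)"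
        using assms u w' by (intro powr_mono2') auto
      show "(norm (deriv f u) * (1 - (norm u)\<^sup>2)) powr p \<le> ((2 * N) * (1 - norm (B u))) powr p"
        using assms * w by (intro powr_mono2) auto
    qed auto
    also have "\<dots> = (2 * N) powr p * ((1 - norm u) powr (\<alpha> - p) * (1 - norm (B u)) powr p)"
      using N B1 by (simp add: powr_mult)
    finally show ?thesis .
  qed
  have meas: "(\<lambda>u. ennreal ((1 - norm u) powr (\<alpha> - p) * (1 - norm (B u)) powr p) * indicator (ball 0 1) u)
      \<in> borel_measurable lborel"
  proof -
    have [measurable]: "B \<in> borel_measurable borel"
      unfolding B_def blaschke_product_def [abs_def] blaschke_factor_def by measurable
    have [measurable]: "ball (0::complex) 1 \<in> sets borel" by simp
    show ?thesis by measurable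
  qed
  have "(\<integral>\<^sup>+u \<in> ball 0 1. ennreal ((1 - (norm u)\<^sup>2) powr \<alpha> * norm (deriv f u) powr p) \<partial>lborel)
      \<le> (\<integral>\<^sup>+u. ennreal ((2 * N) powr p) *
        (ennreal ((1 - norm u) powr (\<alpha> - p) * (1 - norm (B u)) powr p) * indicator (ball 0 1) u) \<partial>lborel)"
  proof (intro nn_integral_mono)
    fix u :: complex
    show "ennreal ((1 - (norm u)\<^sup>2) powr \<alpha> * norm (deriv f u) powr p) * indicator (ball 0 1) u
      \<le> ennreal ((2 * N) powr p) *
        (ennreal ((1 - norm u) powr (\<alpha> - p) * (1 - norm (B u)) powr p) * indicator (ball 0 1) u)"
    proof (cases "norm u < 1")
      case True
      show ?thesis
        using ennreal_leI [OF pointwise [OF True]] True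
          ennreal_mult' [of "(2 * N) powr p" "(1 - norm u) powr (\<alpha> - p) * (1 - norm (B u)) powr p"]
        by simp
    qed simp
  qed
  also have "\<dots> = ennreal ((2 * N) powr p) *
      (\<integral>\<^sup>+u \<in> ball 0 1. ennreal ((1 - norm u) powr (\<alpha> - p) * (1 - norm (B u)) powr p) \<partial>lborel)"
    by (rule nn_integral_cmult [OF meas])
  also have "\<dots> \<le> ennreal ((2 * N) powr p) * (ennreal (2 * ((p - 1 - \<alpha>) / p) powr (- p)) * I)"
    unfolding B_def I_def by (intro mult_left_mono blaschke_radial_Hardy l assms) auto
  also have "\<dots> = ennreal ((2 * N) powr p * (2 * ((p - 1 - \<alpha>) / p) powr (- p))) * I"
    by (subst ennreal_mult') (simp_all only: mult.assoc powr_ge_zero)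
  \<comment> \<open>Regrouped so that \<open>N powr p\<close> multiplies the left-hand side of
    \<open>K_const_powr_ge\<close>.\<close>
  also have "(2 * N) powr p * (2 * c) = N powr p * (2 * (2 powr p * c))" for c
    using N by (simp add: powr_mult)
  also have "ennreal (N powr p * (2 * (2 powr p * ((p - 1 - \<alpha>) / p) powr (- p)))) * I
      \<le> ennreal ((K_const p \<alpha> * N) powr p) * I"
  proof (intro mult_right_mono ennreal_leI)
    have "N powr p * (2 * (2 powr p * ((p - 1 - \<alpha>) / p) powr (- p))) \<le> N powr p * K_const p \<alpha> powr p"
      by (intro mult_left_mono K) auto
    then show "N powr p * (2 * (2 powr p * ((p - 1 - \<alpha>) / p) powr (- p))) \<le> (K_const p \<alpha> * N) powr p"
      using N K(2) by (simp add: powr_mult mult.commute)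
  qed auto
  finally have "bergman_norm p \<alpha> (deriv f) \<le> ennreal (K_const p \<alpha> * N) * bergman_norm p \<alpha> (deriv B)"
    unfolding I_def using N K(2) assms by (intro bergman_norm_le) auto
  then show ?thesis
    using N K(2) by (simp add: bmoa B_def ennreal_mult)
qed

end
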